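(* Let $\mathcal{M}$ be a model of Presburger arithmetic and let $(G,\cdot,e_G)$ be a group definable (with parameters) in $\mathcal{M}$. Then $G$ is definably abelian-by-finite: there is a definable abelian subgroup $G'$ of $G$ of finite index in $G$.
   Context: Presburger arithmetic is the complete theory $T=\mathrm{Th}(\mathbb{Z},+,-,<,0,1,\{\equiv_n\}_{n\in\mathbb{N}})$, where $\equiv_n$ is congruence modulo $n$. A definable group is a definable set $G\subseteq \mathcal{M}^m$ together with a definable group operation. *)

theory Defs
  imports "HOL-Algebra.Coset" "HOL-Number_Theory.Cong"
begin

datatype pterm = Var nat | Zero | One | Add pterm pterm | Sub pterm pterm

datatype pform =
    FFalse
  | Eq pterm pterm
  | Less pterm pterm
  | Cong nat pterm pterm
  | Neg pform
  | Conj pform pform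
  | Ex nat pform

text \<open>An L-structure; the universe is the whole carrier type.\<close>
record 'a pstruct =
  padd  :: "'a \<Rightarrow> 'a \<Rightarrow> 'a"
  psub  :: "'a \<Rightarrow> 'a \<Rightarrow> 'a"
  plt   :: "'a \<Rightarrow> 'a \<Rightarrow> bool"
  pzero :: 'a
  pone  :: 'a
  pcong :: "nat \<Rightarrow> 'a \<Rightarrow> 'a \<Rightarrow> bool"

fun teval :: "'a pstruct \<Rightarrow> (nat \<Rightarrow> 'a) \<Rightarrow> pterm \<Rightarrow> 'a" where
  "teval M e (Var i) = e i"
| "teval M e Zero = pzero M"
| "teval M e One = pone M"
| "teval M e (Add s t) = padd M (teval M e s) (teval M e t)"
| "teval M e (Sub s t) = psub M (teval M e s) (teval M e t)"

fun holds :: "'a pstruct \<Rightarrow> pform \<Rightarrow> (nat \<Rightarrow> 'a) \<Rightarrow> bool" where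
  "holds M FFalse e = False"
| "holds M (Eq s t) e = (teval M e s = teval M e t)"
| "holds M (Less s t) e = plt M (teval M e s) (teval M e t)"
| "holds M (Cong n s t) e = pcong M n (teval M e s) (teval M e t)"
| "holds M (Neg \<phi>) e = (\<not> holds M \<phi> e)"
| "holds M (Conj \<phi> \<psi>) e = (holds M \<phi> e \<and> holds M \<psi> e)"
| "holds M (Ex x \<phi>) e = (\<exists>a. holds M \<phi> (e(x := a)))"

fun tvars :: "pterm \<Rightarrow> nat set" where
  "tvars (Var i) = {i}"
| "tvars Zero = {}"
| "tvars One = {}"
| "tvars (Add s t) = tvars s \<union> tvars t"
| "tvars (Sub s t) = tvars s \<union> tvars t"

fun fvars :: "pform \<Rightarrow> nat set" where
  "fvars FFalse = {}"
| "fvars (Eq s t) = tvars s \<union> tvars t"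
| "fvars (Less s t) = tvars s \<union> tvars t"
| "fvars (Cong n s t) = tvars s \<union> tvars t"
| "fvars (Neg \<phi>) = fvars \<phi>"
| "fvars (Conj \<phi> \<psi>) = fvars \<phi> \<union> fvars \<psi>"
| "fvars (Ex x \<phi>) = fvars \<phi> - {x}"

definition sentence :: "pform \<Rightarrow> bool" where
  "sentence \<phi> \<longleftrightarrow> fvars \<phi> = {}"

definition Zstr :: "int pstruct" where
  "Zstr = \<lparr> padd = (+), psub = (-), plt = (<), pzero = 0, pone = 1,
            pcong = (\<lambda>n a b. [a = b] (mod int n)) \<rparr>"

definition presburger_model :: "'a pstruct \<Rightarrow> bool" where
  "presburger_model M \<longleftrightarrow>
     (\<forall>\<phi>. sentence \<phi> \<longrightarrow> (\<forall>e. holds Zstr \<phi> e) \<longrightarrow> (\<forall>e. holds M \<phi> e))"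

text \<open>Definable (with parameters) subsets of M^m; tuples are lists of length m.
  Variables 0..m-1 are the tuple coordinates, all other variables are parameters
  given by the assignment p.\<close>
definition definable :: "'a pstruct \<Rightarrow> nat \<Rightarrow> 'a list set \<Rightarrow> bool" where
  "definable M m S \<longleftrightarrow>
     (\<exists>\<phi> p. S = {xs. length xs = m \<and> holds M \<phi> (\<lambda>i. if i < m then xs ! i else p i)})"

definition definable_group :: "'a pstruct \<Rightarrow> nat \<Rightarrow> ('a list, 'b) monoid_scheme \<Rightarrow> bool" where
  "definable_group M m G \<longleftrightarrow>
     group G \<and> carrier G \<subseteq> {xs. length xs = m} \<and> definable M m (carrier G) \<and>
     definable M (3 * m)
       {xs @ ys @ zs | xs ys zs. xs \<in> carrier G \<and> ys \<in> carrier G \<and> zs = xs \<otimes>\<^bsub>G\<^esub> ys}"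

end

theory Submission
  imports Defs "HOL-Library.Infinite_Set" "HOL-Library.Nat_Bijection"
begin

text \<open>
  By transfer it is enough to treat groups \<open>G \<subseteq> \<int>\<^sup>m\<close> with bounds that depend only on the defining
  formulas. Quantifier elimination shows that the coordinates of \<open>x y z\<close> are piecewise linear. Splitting
  every linear inequality at medians, any finite sets \<open>X, Y, Z \<subseteq> G\<close> contain subsets of a fixed
  proportion on which \<open>x y z\<close> is additively separable, so that \<open>h z g = h' z g'\<close> implies
  \<open>h z' g = h' z' g'\<close>, that is, \<open>h'\<^sup>-\<^sup>1 h\<close> commutes with \<open>z' z\<^sup>-\<^sup>1\<close>.

  Balls of \<open>G\<close> grow polynomially and multiplication is linearly bounded, so for infinitely many radii
  \<open>R\<close> the number of pairwise disjoint translates of a set of positive proportion in the ball of radius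
  \<open>R\<close> is bounded. Applied to balls, the commutation above gives dense sets \<open>D R\<close> whose centralizers
  meet the ball of radius \<open>R\<close> with bounded index. Passing to the limit in \<open>R\<close> yields a finite set
  \<open>E\<close> of bounded size such that \<open>C(E)\<close> and \<open>C(C(E))\<close> both have bounded index; their intersection, the center of
  \<open>C(E)\<close>, is the required abelian subgroup.
\<close>

section \<open>Groups with separated products\<close>

text \<open>For this the centralized set must be finite, of a size known in advance, and
  \<open>r\<close> and \<open>N\<close> must be found before the parameters are given. Accordingly
  \<open>C\<close> and \<open>q\<close> come from \<open>m\<close> and \<open>\<psi>\<close> alone.
  Only the additive constant \<open>c\<close> in the norm of a product depends on the parameters,
  and it does no harm because only radii above \<open>c\<close> are used.

  The obstacle is that the pieces on which the product is linear are not products of sets; passing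
  to dense subsets of finite sets replaces them by boxes. Three factors are used because the middle
  one can then vary freely: \<open>h z g = h' z g'\<close> says that h'^-1 h = z (g' g^-1) z^-1, and
  two such equations with the same outer factors express a commutation.\<close>

lemma packing:
  fixes F :: "'i \<Rightarrow> 'x set"
  assumes "finite S" "finite U" "\<And>i. i \<in> S \<Longrightarrow> F i \<subseteq> U"
    and disj: "\<And>i j. i \<in> S \<Longrightarrow> j \<in> S \<Longrightarrow> i \<noteq> j \<Longrightarrow> F i \<inter> F j = {}"
    and big: "\<And>i. i \<in> S \<Longrightarrow> n \<le> q * card (F i)"
    and "card U \<le> K * n" and "0 < n"
  shows "card S \<le> q * K"
proof -
  have fin: "finite (F i)" if "i \<in> S" for i
    using assms(2,3) that finite_subset by blast
  have "card S * n = (\<Sum>i\<in>S. n)" by simp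
  also have "\<dots> \<le> (\<Sum>i\<in>S. q * card (F i))" by (rule sum_mono) (use big in auto)
  also have "\<dots> = q * (\<Sum>i\<in>S. card (F i))" by (simp add: sum_distrib_left)
  also have "(\<Sum>i\<in>S. card (F i)) = card (\<Union>i\<in>S. F i)"
    using assms(1) fin disj by (intro card_UN_disjoint [symmetric]) auto
  also have "\<dots> \<le> card U" using assms(2,3) by (intro card_mono) auto
  also have "q * card U \<le> q * (K * n)" using assms(6) by simp
  finally have "card S * n \<le> (q * K) * n" by (simp add: algebra_simps)
  then show ?thesis using \<open>0 < n\<close> by simp
qed

text \<open>If the inequality failed from some radius on, iterating along \<open>l ^ j * r\<close>
  would force growth at least \<open>(2 * l ^ m) ^ j\<close>, whereas the polynomial bound allows
  only a constant times \<open>(l ^ m) ^ j\<close>. The factor 2 makes the two incompatible.\<close>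

lemma polynomial_growth_doubling:
  fixes n :: "nat \<Rightarrow> nat"
  assumes pos: "\<And>R. R0 \<le> R \<Longrightarrow> 0 < n R"
    and poly: "\<And>R. n R \<le> (2 * R + 1) ^ m" and "1 \<le> l"
  shows "\<exists>R\<ge>R1. n (l * R) \<le> 2 * l ^ m * n R"
proof (rule ccontr)
  assume "\<not> ?thesis"
  then have neg: "2 * l ^ m * n R < n (l * R)" if "R1 \<le> R" for R
    using that by force
  \<comment> \<open>Besides passing both thresholds, \<open>r\<close> is at least 1, so that
    \<open>2 * x + 1 \<le> 3 * x\<close> for every \<open>x = l ^ j * r\<close>.\<close>
  define r where "r = max (max R0 R1) 1"
  have up: "r \<le> l ^ j * r" for j using \<open>1 \<le> l\<close> by simp
  have grow: "(2 * l ^ m) ^ j \<le> n (l ^ j * r)" for j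
  proof (induction j)
    case 0 show ?case using pos[of r] by (simp add: r_def Suc_le_eq)
  next
    case (Suc j)
    have "R1 \<le> l ^ j * r" using up[of j] by (simp add: r_def)
    from neg[OF this] have "2 * l ^ m * n (l ^ j * r) \<le> n (l ^ Suc j * r)"
      by (simp add: mult.assoc)
    moreover have "(2 * l ^ m) ^ Suc j \<le> 2 * l ^ m * n (l ^ j * r)" using Suc by simp
    ultimately show ?case by linarith
  qed
  have "2 ^ j \<le> (3 * r) ^ m" for j :: nat
  proof -
    have "2 * (l ^ j * r) + 1 \<le> l ^ j * (3 * r)"
      using \<open>1 \<le> l\<close> up[of j] by (simp add: r_def)
    then have "n (l ^ j * r) \<le> (l ^ j * (3 * r)) ^ m"
      using poly[of "l ^ j * r"] power_mono le_trans by blast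
    also have "\<dots> = (l ^ m) ^ j * (3 * r) ^ m"
      by (simp add: power_mult_distrib power_mult [symmetric] mult.commute)
    finally have "(2 * l ^ m) ^ j \<le> (l ^ m) ^ j * (3 * r) ^ m"
      using grow[of j] by linarith
    then have "(l ^ m) ^ j * 2 ^ j \<le> (l ^ m) ^ j * (3 * r) ^ m"
      by (simp only: power_mult_distrib mult.commute[of "2 ^ j"])
    then show ?thesis using \<open>1 \<le> l\<close> by simp
  qed
  from this[of "(3 * r) ^ m"] show False
    using less_exp[of "(3 * r) ^ m"] by linarith
qed

section \<open>Centralizers, separated sets and index bounds\<close>

context group
begin

definition centr :: "'a set \<Rightarrow> 'a set" where
  "centr S = {x \<in> carrier G. \<forall>s\<in>S. x \<otimes> s = s \<otimes> x}"

text \<open>The elements of \<open>S\<close> represent distinct left cosets when \<open>A\<close> is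
  a subgroup. A bound on the size of all separated sets replaces a bound on the index: it can be
  tested on finite sets inside balls, and it can be written as a formula.\<close>

definition separated :: "'a set \<Rightarrow> 'a set \<Rightarrow> bool" where
  "separated A S \<longleftrightarrow> finite S \<and> S \<subseteq> carrier G \<and> (\<forall>a\<in>S. \<forall>b\<in>S. a \<noteq> b \<longrightarrow> inv a \<otimes> b \<notin> A)"

lemma subgroup_centr:
  assumes "S \<subseteq> carrier G"
  shows "subgroup (centr S) G"
proof
  show "centr S \<subseteq> carrier G" by (auto simp: centr_def)
  show "\<one> \<in> centr S" using assms by (auto simp: centr_def)
  fix x assume x: "x \<in> centr S"
  have "inv x \<otimes> s = s \<otimes> inv x" if "s \<in> S" for s
  proof -
    have c: "x \<in> carrier G" "s \<in> carrier G" and xs: "x \<otimes> s = s \<otimes> x"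
      using x that assms by (auto simp: centr_def)
    have "inv x \<otimes> s = inv x \<otimes> (s \<otimes> x) \<otimes> inv x" using c by (simp add: m_assoc)
    also have "\<dots> = inv x \<otimes> x \<otimes> (s \<otimes> inv x)" using c by (simp only: xs[symmetric] m_assoc inv_closed m_closed)
    finally show ?thesis using c by simp
  qed
  then show "inv x \<in> centr S" using x by (simp add: centr_def)
  fix y assume y: "y \<in> centr S"
  have "(x \<otimes> y) \<otimes> s = s \<otimes> (x \<otimes> y)" if "s \<in> S" for s
  proof -
    have c: "x \<in> carrier G" "y \<in> carrier G" "s \<in> carrier G" "x \<otimes> s = s \<otimes> x" "y \<otimes> s = s \<otimes> y"
      using x y that assms by (auto simp: centr_def)
    have "x \<otimes> y \<otimes> s = x \<otimes> s \<otimes> y" using c(1-3) by (simp add: m_assoc c(5))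
    also have "\<dots> = s \<otimes> (x \<otimes> y)" using c(1-3) unfolding c(4) by (intro m_assoc)
    finally show ?thesis .
  qed
  then show "x \<otimes> y \<in> centr S" using x y by (simp add: centr_def)
qed

lemma left_rel_sym:
  assumes "subgroup A G" "a \<in> carrier G" "b \<in> carrier G" "inv a \<otimes> b \<in> A"
  shows "inv b \<otimes> a \<in> A"
  using subgroup.m_inv_closed[OF assms(1,4)] assms by (simp add: inv_mult_group)

lemma left_rel_trans:
  assumes "subgroup A G" "a \<in> carrier G" "b \<in> carrier G" "c \<in> carrier G"
    and "inv a \<otimes> b \<in> A" "inv b \<otimes> c \<in> A"
  shows "inv a \<otimes> c \<in> A"
proof -
  have "inv a \<otimes> c = (inv a \<otimes> b) \<otimes> (inv b \<otimes> c)"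
    using assms(2-4) by (simp add: m_assoc m_assoc[symmetric, of b "inv b"])
  then show ?thesis using assms subgroup.m_closed by metis
qed

lemma separated_insert:
  assumes "subgroup A G" "separated A S" "x \<in> carrier G" "\<And>s. s \<in> S \<Longrightarrow> inv s \<otimes> x \<notin> A"
  shows "separated A (insert x S)"
  using assms left_rel_sym[OF assms(1)] by (auto simp: separated_def subset_iff)

lemma maximal_separated:
  assumes "finite X" "X \<subseteq> carrier G" "subgroup A G"
  obtains I where "I \<subseteq> X" "separated A I" "\<And>x. x \<in> X \<Longrightarrow> \<exists>i\<in>I. inv i \<otimes> x \<in> A"
proof -
  let ?P = "\<lambda>I. I \<subseteq> X \<and> separated A I"
  have "?P {}" by (simp add: separated_def)
  moreover have "\<forall>I. ?P I \<longrightarrow> card I < Suc (card X)"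
    using assms(1) by (simp add: card_mono le_imp_less_Suc)
  ultimately obtain I where I: "?P I" "\<And>J. ?P J \<Longrightarrow> card J \<le> card I"
    using ex_has_greatest_nat[of ?P "{}" card "Suc (card X)"] by metis
  have "\<exists>i\<in>I. inv i \<otimes> x \<in> A" if x: "x \<in> X" for x
  proof (rule ccontr)
    assume neg: "\<not> ?thesis"
    have xc: "x \<in> carrier G" using x assms(2) by blast
    have "inv x \<otimes> x \<in> A" using xc subgroup.one_closed[OF assms(3)] by simp
    with neg have "x \<notin> I" by blast
    have "?P (insert x I)" using I(1) x xc neg separated_insert[OF assms(3)] by blast
    then have "card (insert x I) \<le> card I" by (rule I(2))
    moreover have "finite I" using I(1) by (simp add: separated_def)
    ultimately show False using \<open>x \<notin> I\<close> by simp
  qed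
  with I(1) that show thesis by blast
qed

text \<open>Sort \<open>S\<close> by left cosets of \<open>A\<close>. Quotients inside one coset
  already lie in \<open>A\<close>, so there the elements must be separated by
  \<open>B\<close>.\<close>

lemma separated_Int_bound:
  assumes "subgroup A G"
    and A: "\<And>S. separated A S \<Longrightarrow> card S \<le> p" and B: "\<And>S. separated B S \<Longrightarrow> card S \<le> q"
    and S: "separated (A \<inter> B) S"
  shows "card S \<le> p * q"
proof -
  have fin: "finite S" and sub: "S \<subseteq> carrier G" using S by (auto simp: separated_def)
  obtain I where I: "I \<subseteq> S" "separated A I" "\<And>x. x \<in> S \<Longrightarrow> \<exists>i\<in>I. inv i \<otimes> x \<in> A"
    using maximal_separated[OF fin sub assms(1)] by blast
  have finI: "finite I" using I(2) by (simp add: separated_def)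
  define T where "T i = {s \<in> S. inv i \<otimes> s \<in> A}" for i
  have "card (T i) \<le> q" if i: "i \<in> I" for i
  proof (rule B)
    have "inv a \<otimes> b \<in> A" if "a \<in> T i" "b \<in> T i" for a b
    proof -
      have "a \<in> carrier G" "b \<in> carrier G" "i \<in> carrier G" using that sub i I(1) by (auto simp: T_def)
      then show ?thesis
        using that left_rel_trans[OF assms(1)] left_rel_sym[OF assms(1)] unfolding T_def by blast
    qed
    then show "separated B (T i)" using S by (auto simp: separated_def T_def)
  qed
  then have "(\<Sum>i\<in>I. card (T i)) \<le> card I * q" using sum_bounded_above[of I "\<lambda>i. card (T i)" q] by simp
  moreover have "card (\<Union>i\<in>I. T i) \<le> (\<Sum>i\<in>I. card (T i))" by (rule card_UN_le [OF finI])
  moreover have "S = (\<Union>i\<in>I. T i)" using I(3) by (auto simp: T_def)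
  ultimately show ?thesis using A[OF I(2)] by (metis le_trans mult_le_mono1)
qed

lemma finite_rcosets_of_separated_bound:
  assumes "subgroup A G" and bound: "\<And>S. separated A S \<Longrightarrow> card S \<le> p"
  shows "finite (rcosets A)"
proof (rule ccontr)
  assume "infinite (rcosets A)"
  then obtain Q where Q: "Q \<subseteq> rcosets A" "finite Q" "card Q = Suc p"
    using infinite_arbitrarily_large by blast
  have "\<exists>r. r \<in> carrier G \<and> C = A #> r" if "C \<in> Q" for C
    using that Q(1) by (auto simp: RCOSETS_def)
  then obtain r where r: "\<And>C. C \<in> Q \<Longrightarrow> r C \<in> carrier G \<and> C = A #> r C" by metis
  \<comment> \<open>Inversion turns representatives of right cosets into representatives of left
    cosets, which \<open>separated\<close> measures.\<close>
  let ?s = "\<lambda>C. inv (r C)"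
  have key: "C = C'" if "C \<in> Q" "C' \<in> Q" "inv (?s C) \<otimes> ?s C' \<in> A" for C C'
  proof -
    have "r C \<otimes> inv (r C') \<in> A" using that r by simp
    then have "r C \<in> A #> r C'"
      using r that subgroup.rcos_module_rev[OF assms(1) is_group] by blast
    then show ?thesis using r that repr_independence[OF _ _ assms(1)] by metis
  qed
  have inj: "inj_on ?s Q"
  proof (rule inj_onI)
    fix C C' assume "C \<in> Q" "C' \<in> Q" "?s C = ?s C'"
    then show "C = C'" using key[of C C'] r subgroup.one_closed[OF assms(1)] by simp
  qed
  have "separated A (?s ` Q)" using Q(2) r key by (auto simp: separated_def)
  then have "card (?s ` Q) \<le> p" by (rule bound)
  then show False using Q(3) card_image[OF inj] by simp
qed

text \<open>With u = h'^-1 h and t = g' g^-1, the two equations say u z = z t and u z' = z' t. Hence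
  u z' z^-1 = z' t z^-1 = z' z^-1 u.\<close>

lemma commute_of_matching:
  assumes c: "h \<in> carrier G" "h' \<in> carrier G" "z \<in> carrier G" "z' \<in> carrier G" "g \<in> carrier G" "g' \<in> carrier G"
    and e: "h \<otimes> z \<otimes> g = h' \<otimes> z \<otimes> g'" and e': "h \<otimes> z' \<otimes> g = h' \<otimes> z' \<otimes> g'"
  shows "inv h' \<otimes> h \<otimes> (z' \<otimes> inv z) = z' \<otimes> inv z \<otimes> (inv h' \<otimes> h)"
proof -
  define u where "u = inv h' \<otimes> h"
  have u: "u \<in> carrier G" using c by (simp add: u_def)
  have *: "u \<otimes> y = y \<otimes> (g' \<otimes> inv g)" if "y \<in> carrier G" "h \<otimes> y \<otimes> g = h' \<otimes> y \<otimes> g'" for y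
  proof -
    have "h \<otimes> y = h' \<otimes> y \<otimes> g' \<otimes> inv g"
      using that c by (metis inv_solve_right m_closed)
    then have "h \<otimes> y = h' \<otimes> (y \<otimes> (g' \<otimes> inv g))" using c that by (simp add: m_assoc)
    then have "inv h' \<otimes> (h \<otimes> y) = y \<otimes> (g' \<otimes> inv g)"
      using c that by (simp add: inv_solve_left')
    then show ?thesis using c that by (simp add: u_def m_assoc)
  qed
  have "u \<otimes> (z' \<otimes> inv z) = z' \<otimes> (g' \<otimes> inv g) \<otimes> inv z"
    using *[OF c(4) e'] c u by (metis inv_closed m_assoc)
  moreover have "inv z \<otimes> u = g' \<otimes> inv g \<otimes> inv z"
  proof -
    have "u = z \<otimes> (g' \<otimes> inv g) \<otimes> inv z" using *[OF c(3) e] c u by (metis inv_solve_right m_closed inv_closed)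
    then have "inv z \<otimes> u = inv z \<otimes> (z \<otimes> (g' \<otimes> inv g \<otimes> inv z))" using c by (simp add: m_assoc)
    then show ?thesis using c by (simp add: m_assoc[symmetric])
  qed
  ultimately show ?thesis using c u unfolding u_def[symmetric] by (metis inv_closed m_assoc m_closed)
qed

end

section \<open>Balls, good radii and dense sets with large centralizers\<close>

lemma (in group) quotient_eq:
  assumes "a \<in> carrier G" "b \<in> carrier G" "x \<in> carrier G" "y \<in> carrier G" "a \<otimes> x = b \<otimes> y"
  shows "inv a \<otimes> b = x \<otimes> inv y"
proof -
  have "x = inv a \<otimes> (b \<otimes> y)" using assms by (simp add: inv_solve_left)
  then have "x = inv a \<otimes> b \<otimes> y" using assms by (simp add: m_assoc)
  then show ?thesis using assms by (simp add: m_assoc)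
qed

text \<open>This is all that the argument needs from a group definable over the integers. The index
  bounds derived below are built from \<open>C\<close>, \<open>m\<close> and \<open>q\<close>; the
  constant \<open>c\<close> enters only as a lower bound for the radii.\<close>

locale separating_group = group +
  fixes \<nu> :: "'a \<Rightarrow> nat" and C c m q :: nat
  assumes C: "1 \<le> C" and q: "1 \<le> q"
    and finite_ball: "finite {x \<in> carrier G. \<nu> x \<le> R}"
    and card_ball: "card {x \<in> carrier G. \<nu> x \<le> R} \<le> (2 * R + 1) ^ m"
    and norm_mult: "\<lbrakk>x \<in> carrier G; y \<in> carrier G\<rbrakk> \<Longrightarrow> \<nu> (x \<otimes> y) \<le> C * (\<nu> x + \<nu> y) + c"
    and separate: "\<lbrakk>finite X; finite Y; finite Z; X \<subseteq> carrier G; Y \<subseteq> carrier G; Z \<subseteq> carrier G\<rbrakk> \<Longrightarrow>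
      \<exists>X'\<subseteq>X. \<exists>Y'\<subseteq>Y. \<exists>Z'\<subseteq>Z. card X \<le> q * card X' \<and> card Y \<le> q * card Y' \<and> card Z \<le> q * card Z' \<and>
        (\<forall>h\<in>X'. \<forall>h'\<in>X'. \<forall>z\<in>Y'. \<forall>z'\<in>Y'. \<forall>g\<in>Z'. \<forall>g'\<in>Z'.
           h \<otimes> z \<otimes> g = h' \<otimes> z \<otimes> g' \<longrightarrow> h \<otimes> z' \<otimes> g = h' \<otimes> z' \<otimes> g')"
begin

definition ball :: "nat \<Rightarrow> 'a set" where
  "ball R = {x \<in> carrier G. \<nu> x \<le> R}"

text \<open>For \<open>c \<le> R\<close>, two elements of \<open>ball R\<close> have a product of
  norm at most \<open>3 * C * R\<close>; a third factor gives at most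
  \<open>C * (3 * C * R + C * R) + C * (C * R)\<close>, whence the 5. \<open>K\<close> is the growth
  factor that \<open>polynomial_growth_doubling\<close> yields for this dilation.\<close>

abbreviation dil :: nat where "dil \<equiv> 5 * C\<^sup>2"
abbreviation K :: nat where "K \<equiv> 2 * dil ^ m"

lemma ball_mult2:
  assumes "x \<in> ball R" "y \<in> ball R" "c \<le> R"
  shows "x \<otimes> y \<in> ball (3 * C * R)"
proof -
  have "\<nu> (x \<otimes> y) \<le> C * (\<nu> x + \<nu> y) + c" using assms by (intro norm_mult) (auto simp: ball_def)
  also have "\<dots> \<le> C * (R + R) + C * R"
    using assms C by (intro add_mono mult_mono) (auto simp: ball_def intro: order_trans[of _ R])
  finally show ?thesis using assms by (simp add: ball_def algebra_simps)
qed

lemma dil_ge: "3 * C * R \<le> dil * R"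
proof -
  have "3 * C \<le> 5 * C\<^sup>2" using C by (simp add: power2_eq_square)
  then show ?thesis by (rule mult_le_mono1)
qed

lemma ball_mult3:
  assumes "x \<in> ball R" "y \<in> ball R" "z \<in> ball R" "c \<le> R"
  shows "x \<otimes> y \<otimes> z \<in> ball (dil * R)"
proof -
  have xy: "x \<otimes> y \<in> ball (3 * C * R)" using assms by (intro ball_mult2)
  have "\<nu> (x \<otimes> y \<otimes> z) \<le> C * (\<nu> (x \<otimes> y) + \<nu> z) + c"
    using assms by (intro norm_mult) (auto simp: ball_def)
  also have "\<dots> \<le> C * (3 * C * R + C * R) + C * (C * R)"
  proof (intro add_mono mult_mono)
    show "\<nu> (x \<otimes> y) \<le> 3 * C * R" using xy by (simp add: ball_def)
    show "\<nu> z \<le> C * R" using assms(3) C by (auto simp: ball_def intro: order_trans[of _ R])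
    have "R \<le> C * (C * R)" using C by simp
    then show "c \<le> C * (C * R)" using assms(4) by linarith
  qed auto
  also have "\<dots> = dil * R" by (simp add: power2_eq_square algebra_simps)
  finally show ?thesis using assms by (simp add: ball_def)
qed

lemma infinitely_many_good_radii: "\<exists>R\<ge>R1. c \<le> R \<and> \<one> \<in> ball R \<and> card (ball (dil * R)) \<le> K * card (ball R)"
proof -
  have pos: "0 < card (ball R)" if "\<nu> \<one> \<le> R" for R
    using that finite_ball by (auto simp: ball_def card_gt_0_iff)
  have dil1: "1 \<le> dil" using C by simp
  have "\<exists>R\<ge>max R1 (max c (\<nu> \<one>)). card (ball (dil * R)) \<le> 2 * dil ^ m * card (ball R)"
    by (rule polynomial_growth_doubling[OF pos _ dil1]) (use card_ball in \<open>auto simp: ball_def\<close>)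
  then show ?thesis by (auto simp: ball_def)
qed

text \<open>The set \<open>D\<close> is a translate \<open>h Y' z\<^sup>-\<^sup>1 h\<^sup>-\<^sup>1\<close> of one of the three sets
  \<open>X'\<close>, \<open>Y'\<close>, \<open>Z'\<close> that separate the balls of radius \<open>R\<close>. If \<open>h z Z'\<close> and \<open>h' z Z'\<close> meet, then
  \<open>h'\<^sup>-\<^sup>1 h\<close> centralizes \<open>Y' z\<^sup>-\<^sup>1\<close>, so by packing a large part of \<open>X'\<close> lies in one
  coset of that centralizer.\<close>

lemma good_radius:
  assumes "c \<le> R" "\<one> \<in> ball R" and doubling: "card (ball (dil * R)) \<le> K * card (ball R)"
  obtains D where "D \<subseteq> carrier G"
    "\<And>S. S \<subseteq> ball R \<Longrightarrow> separated (centr D) S \<Longrightarrow> card S \<le> q * (q * K) * K"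
    "\<And>A S. subgroup A G \<Longrightarrow> D \<subseteq> A \<Longrightarrow> S \<subseteq> ball R \<Longrightarrow> separated A S \<Longrightarrow> card S \<le> q * K"
proof -
  let ?B = "ball R"
  have fin: "finite (ball r)" and sub: "ball r \<subseteq> carrier G" for r
    using finite_ball by (auto simp: ball_def)
  have n: "0 < card ?B" using assms(2) fin by (auto simp: card_gt_0_iff)
  obtain X Y Z where XYZ: "X \<subseteq> ?B" "Y \<subseteq> ?B" "Z \<subseteq> ?B"
    and X: "card ?B \<le> q * card X" and Y: "card ?B \<le> q * card Y" and Z: "card ?B \<le> q * card Z"
    and sep: "\<forall>h\<in>X. \<forall>h'\<in>X. \<forall>z\<in>Y. \<forall>z'\<in>Y. \<forall>g\<in>Z. \<forall>g'\<in>Z.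
      h \<otimes> z \<otimes> g = h' \<otimes> z \<otimes> g' \<longrightarrow> h \<otimes> z' \<otimes> g = h' \<otimes> z' \<otimes> g'"
    using separate[OF fin fin fin sub sub sub, of R R R] by (elim exE conjE) (rule that)
  have match: "h \<otimes> z' \<otimes> g = h' \<otimes> z' \<otimes> g'"
    if "h \<in> X" "h' \<in> X" "z \<in> Y" "z' \<in> Y" "g \<in> Z" "g' \<in> Z" "h \<otimes> z \<otimes> g = h' \<otimes> z \<otimes> g'"
    for h h' z z' g g'
    using sep that by blast
  have finX: "finite X" using XYZ(1) fin finite_subset by blast
  have cX: "X \<subseteq> carrier G" and cY: "Y \<subseteq> carrier G" and cZ: "Z \<subseteq> carrier G"
    using XYZ sub by blast+
  have "Y \<noteq> {}" using Y n by auto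
  then obtain z where z: "z \<in> Y" by blast
  have zc: "z \<in> carrier G" using z cY by blast
  define E where "E = centr ((\<lambda>y. y \<otimes> inv z) ` Y)"
  have E: "subgroup E G" unfolding E_def using cY zc by (intro subgroup_centr) auto
  have same: "inv h' \<otimes> h \<in> E" if "h \<in> X" "h' \<in> X" "g \<in> Z" "g' \<in> Z" "h \<otimes> z \<otimes> g = h' \<otimes> z \<otimes> g'" for h h' g g'
  proof -
    have "h \<in> carrier G" "h' \<in> carrier G" "g \<in> carrier G" "g' \<in> carrier G" using that cX cZ by auto
    then show ?thesis
      using commute_of_matching[OF _ _ zc _ _ _ that(5)] match[OF that(1,2) z _ that(3,4,5)] cY
      by (auto simp: E_def centr_def subset_iff)
  qed
  obtain I where I: "I \<subseteq> X" "separated E I" "\<And>x. x \<in> X \<Longrightarrow> \<exists>i\<in>I. inv i \<otimes> x \<in> E"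
    using maximal_separated[OF finX cX E] by blast
  have finI: "finite I" using I(2) by (simp add: separated_def)
  have cardI: "card I \<le> q * K"
  proof (rule packing[OF finI, where F = "\<lambda>h. (\<lambda>g. h \<otimes> z \<otimes> g) ` Z" and U = "ball (dil * R)" and n = "card ?B"])
    fix i j assume ij: "i \<in> I" "j \<in> I" "i \<noteq> j"
    show "(\<lambda>g. i \<otimes> z \<otimes> g) ` Z \<inter> (\<lambda>g. j \<otimes> z \<otimes> g) ` Z = {}"
    proof (rule ccontr)
      assume "\<not> ?thesis"
      then obtain g g' where "g \<in> Z" "g' \<in> Z" "j \<otimes> z \<otimes> g = i \<otimes> z \<otimes> g'" by fastforce
      then have "inv i \<otimes> j \<in> E" using same ij I(1) by blast
      then show False using I(2) ij by (simp add: separated_def)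
    qed
  next
    fix i assume i: "i \<in> I"
    have "i \<otimes> z \<in> carrier G" using i I(1) cX zc by auto
    then have "inj_on (\<lambda>g. i \<otimes> z \<otimes> g) Z" using cZ by (intro inj_onI) (auto simp: subset_iff)
    then show "card ?B \<le> q * card ((\<lambda>g. i \<otimes> z \<otimes> g) ` Z)" using Z by (simp add: card_image)
    show "(\<lambda>g. i \<otimes> z \<otimes> g) ` Z \<subseteq> ball (dil * R)"
      using i I(1) XYZ z assms(1) by (auto intro!: ball_mult3)
  qed (use fin doubling n in auto)
  define T where "T i = {x \<in> X. inv i \<otimes> x \<in> E}" for i
  \<comment> \<open>At most \<open>q * K\<close> classes of \<open>E\<close> cover \<open>X\<close>,
    so some class has at least the average size.\<close>
  obtain h where h: "h \<in> I" "card X \<le> (q * K) * card (T h)"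
  proof (rule ccontr)
    assume "\<not> thesis"
    then have small: "(q * K) * card (T i) < card X" if "i \<in> I" for i
      using that \<open>\<And>h. h \<in> I \<Longrightarrow> card X \<le> q * K * card (T h) \<Longrightarrow> thesis\<close> not_le by blast
    have "X \<noteq> {}" using X n by auto
    then have I0: "I \<noteq> {}" using I(3) by blast
    have "X = (\<Union>i\<in>I. T i)" using I(3) by (auto simp: T_def)
    then have "card X \<le> (\<Sum>i\<in>I. card (T i))" using card_UN_le[OF finI, of T] by simp
    then have "(q * K) * card X \<le> (\<Sum>i\<in>I. (q * K) * card (T i))"
      by (metis mult_le_mono2 sum_distrib_left)
    also have "\<dots> < (\<Sum>i\<in>I. card X)" using small I0 finI by (intro sum_strict_mono) auto
    also have "\<dots> = card I * card X" by simp
    also have "\<dots> \<le> (q * K) * card X" using cardI by (rule mult_le_mono1)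
    finally show False by simp
  qed
  have hX: "h \<in> X" and hc: "h \<in> carrier G" using h(1) I(1) cX by auto
  \<comment> \<open>The conjugation by \<open>h\<close> is adapted to the coset \<open>T h\<close>:
    its elements have the form h e with e in \<open>E\<close>, so x y^-1 for x, y in
    \<open>T h\<close> lies in h E h^-1, which centralizes \<open>D\<close>.\<close>
  define D where "D = (\<lambda>y. h \<otimes> y \<otimes> inv z \<otimes> inv h) ` Y"
  have conj: "h \<otimes> e \<otimes> inv h \<in> centr D" if e: "e \<in> E" for e
  proof -
    have ec: "e \<in> carrier G" using e by (simp add: E_def centr_def)
    have "h \<otimes> e \<otimes> inv h \<otimes> (h \<otimes> y \<otimes> inv z \<otimes> inv h) = h \<otimes> y \<otimes> inv z \<otimes> inv h \<otimes> (h \<otimes> e \<otimes> inv h)"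
      if y: "y \<in> Y" for y
    proof -
      have yc: "y \<in> carrier G" using y cY by blast
      have cancel: "inv h \<otimes> (h \<otimes> w) = w" if "w \<in> carrier G" for w
        using that hc by (simp add: m_assoc[symmetric])
      have "e \<otimes> (y \<otimes> inv z) = y \<otimes> inv z \<otimes> e" using e y by (simp add: E_def centr_def)
      then have "h \<otimes> (e \<otimes> (y \<otimes> inv z)) \<otimes> inv h = h \<otimes> (y \<otimes> inv z \<otimes> e) \<otimes> inv h" by simp
      then show ?thesis using hc zc yc ec by (simp add: m_assoc cancel)
    qed
    then show ?thesis using hc ec by (auto simp: centr_def D_def)
  qed
  show thesis
  proof (rule that)
    show "D \<subseteq> carrier G" using hc zc cY by (auto simp: D_def)
    fix S assume S: "S \<subseteq> ?B"
    have finS: "finite S" and cS: "S \<subseteq> carrier G" using S fin sub finite_subset by blast+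
    show "card S \<le> q * (q * K) * K" if "separated (centr D) S"
    \<comment> \<open>Translates of \<open>T h\<close> by elements separated modulo
      \<open>centr D\<close> are disjoint. The coefficient \<open>q * (q * K)\<close> is the loss
      from the ball to \<open>X\<close> times the loss from \<open>X\<close> to
      \<open>T h\<close>.\<close>
    proof (rule packing[OF finS, where F = "\<lambda>a. (\<lambda>x. a \<otimes> x) ` T h" and U = "ball (dil * R)" and n = "card ?B"])
      fix a b assume ab: "a \<in> S" "b \<in> S" "a \<noteq> b"
      show "(\<lambda>x. a \<otimes> x) ` T h \<inter> (\<lambda>x. b \<otimes> x) ` T h = {}"
      proof (rule ccontr)
        assume "\<not> ?thesis"
        then obtain x y where xy: "x \<in> T h" "y \<in> T h" "a \<otimes> x = b \<otimes> y" by fastforce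
        have cc: "a \<in> carrier G" "b \<in> carrier G" "x \<in> carrier G" "y \<in> carrier G"
          using ab cS xy cX by (auto simp: T_def)
        have "inv a \<otimes> b = x \<otimes> inv y"
          using cc xy(3) by (rule quotient_eq)
        also have "\<dots> = h \<otimes> ((inv h \<otimes> x) \<otimes> inv (inv h \<otimes> y)) \<otimes> inv h"
        proof -
          have "h \<otimes> (inv h \<otimes> w) = w" if "w \<in> carrier G" for w
            using that hc by (simp add: m_assoc[symmetric])
          then show ?thesis using cc hc by (simp add: inv_mult_group m_assoc)
        qed
        finally have "inv a \<otimes> b = h \<otimes> ((inv h \<otimes> x) \<otimes> inv (inv h \<otimes> y)) \<otimes> inv h" .
        moreover have "(inv h \<otimes> x) \<otimes> inv (inv h \<otimes> y) \<in> E"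
          using xy E by (simp add: T_def subgroup.m_closed subgroup.m_inv_closed)
        ultimately have "inv a \<otimes> b \<in> centr D" using conj by simp
        then show False using that ab by (simp add: separated_def)
      qed
    next
      fix a assume a: "a \<in> S"
      have ac: "a \<in> carrier G" using a cS by blast
      have "inj_on (\<lambda>x. a \<otimes> x) (T h)" using ac cX by (intro inj_onI) (auto simp: T_def subset_iff)
      moreover have "card ?B \<le> q * ((q * K) * card (T h))"
        using X h(2) by (meson le_trans mult_le_mono2)
      ultimately show "card ?B \<le> q * (q * K) * card ((\<lambda>x. a \<otimes> x) ` T h)"
        by (simp add: card_image mult.assoc)
      have "a \<otimes> x \<in> ball (dil * R)" if "x \<in> T h" for x
      proof -
        have "a \<otimes> x \<in> ball (3 * C * R)" using that a S XYZ(1) assms(1) by (intro ball_mult2) (auto simp: T_def)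
        then show ?thesis unfolding ball_def using le_trans[OF _ dil_ge] by blast
      qed
      then show "(\<lambda>x. a \<otimes> x) ` T h \<subseteq> ball (dil * R)" by blast
    qed (use fin doubling n in auto)
    show "card S \<le> q * K" if A: "subgroup A G" "D \<subseteq> A" and sep: "separated A S" for A
    \<comment> \<open>If a h x = b h y with x, y in \<open>Y\<close>, then a^-1 b is a quotient of
      two elements of \<open>D\<close>, hence lies in \<open>A\<close>. So the sets a h Y are
      disjoint.\<close>
    proof (rule packing[OF finS, where F = "\<lambda>a. (\<lambda>y. a \<otimes> h \<otimes> y) ` Y" and U = "ball (dil * R)" and n = "card ?B"])
      fix a b assume ab: "a \<in> S" "b \<in> S" "a \<noteq> b"
      show "(\<lambda>y. a \<otimes> h \<otimes> y) ` Y \<inter> (\<lambda>y. b \<otimes> h \<otimes> y) ` Y = {}"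
      proof (rule ccontr)
        assume "\<not> ?thesis"
        then obtain x y where xy: "x \<in> Y" "y \<in> Y" "a \<otimes> h \<otimes> x = b \<otimes> h \<otimes> y" by fastforce
        have cc: "a \<in> carrier G" "b \<in> carrier G" "x \<in> carrier G" "y \<in> carrier G"
          using ab cS xy cY by auto
        let ?x = "h \<otimes> x \<otimes> inv z \<otimes> inv h" and ?y = "h \<otimes> y \<otimes> inv z \<otimes> inv h"
        have mem: "?x \<in> A" "?y \<in> A" using xy A(2) by (auto simp: D_def)
        have "a \<otimes> ?x = (a \<otimes> h \<otimes> x) \<otimes> inv z \<otimes> inv h" using cc hc zc by (simp add: m_assoc)
        also have "\<dots> = b \<otimes> ?y" unfolding xy(3) using cc hc zc by (simp add: m_assoc)
        finally have "a \<otimes> ?x = b \<otimes> ?y" .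
        then have "inv a \<otimes> b = ?x \<otimes> inv ?y" using cc hc zc by (intro quotient_eq) auto
        then have "inv a \<otimes> b \<in> A" using mem A(1) by (simp add: subgroup.m_closed subgroup.m_inv_closed)
        then show False using sep ab by (simp add: separated_def)
      qed
    next
      fix a assume a: "a \<in> S"
      have "a \<otimes> h \<in> carrier G" using a cS hc by auto
      then have "inj_on (\<lambda>y. a \<otimes> h \<otimes> y) Y" using cY by (intro inj_onI) (auto simp: subset_iff)
      then show "card ?B \<le> q * card ((\<lambda>y. a \<otimes> h \<otimes> y) ` Y)" using Y by (simp add: card_image)
      show "(\<lambda>y. a \<otimes> h \<otimes> y) ` Y \<subseteq> ball (dil * R)"
        using a S XYZ hX assms(1) by (auto intro!: ball_mult3)
    qed (use fin doubling n in auto)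
  qed
qed

text \<open>Among the finite sets \<open>E\<close> contained in \<open>centr (D R)\<close> for infinitely many good radii \<open>R\<close>
  choose one whose centralizer has maximal index. Its centralizer then commutes with every element
  that lies in infinitely many of the remaining \<open>centr (D R)\<close>, and by the pigeonhole principle
  these elements meet every long enough sequence of quotients.\<close>

lemma centralizer_finite_index:
  obtains E where "E \<subseteq> carrier G" "finite E" "card E \<le> q * K"
    "\<And>S. separated (centr E) S \<Longrightarrow> card S \<le> q * K"
    "\<And>S. separated (centr (centr E)) S \<Longrightarrow> card S \<le> q * (q * K) * K"
proof -
  define good where "good R \<longleftrightarrow> c \<le> R \<and> \<one> \<in> ball R \<and> card (ball (dil * R)) \<le> K * card (ball R)" for R
  have "\<exists>D. D \<subseteq> carrier G \<and>
    (\<forall>S. S \<subseteq> ball R \<longrightarrow> separated (centr D) S \<longrightarrow> card S \<le> q * (q * K) * K) \<and>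
    (\<forall>A S. subgroup A G \<longrightarrow> D \<subseteq> A \<longrightarrow> S \<subseteq> ball R \<longrightarrow> separated A S \<longrightarrow> card S \<le> q * K)"
    if "good R" for R
    using that good_radius[of R] unfolding good_def by metis
  then obtain D where D: "\<And>R. good R \<Longrightarrow> D R \<subseteq> carrier G"
    and D1: "\<And>R S. good R \<Longrightarrow> S \<subseteq> ball R \<Longrightarrow> separated (centr (D R)) S \<Longrightarrow> card S \<le> q * (q * K) * K"
    and D2: "\<And>R A S. good R \<Longrightarrow> subgroup A G \<Longrightarrow> D R \<subseteq> A \<Longrightarrow> S \<subseteq> ball R \<Longrightarrow> separated A S \<Longrightarrow> card S \<le> q * K"
    by metis
  have inf_good: "infinite {R. good R}"
    unfolding infinite_nat_iff_unbounded_le good_def using infinitely_many_good_radii by blast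
  define rad where "rad E = {R. good R \<and> E \<subseteq> centr (D R)}" for E
  have large: "\<exists>R\<in>Q. S \<subseteq> ball R" if "infinite Q" "finite S" "S \<subseteq> carrier G" for Q S
  proof -
    obtain R where "R \<in> Q" "Max (insert 0 (\<nu> ` S)) \<le> R"
      using \<open>infinite Q\<close> infinite_nat_iff_unbounded_le by blast
    then show ?thesis using that by (intro bexI[of _ R]) (auto simp: ball_def)
  qed
  \<comment> \<open>Commutation is symmetric: \<open>E \<subseteq> centr (D R)\<close> gives
    \<open>D R \<subseteq> centr E\<close>, and \<open>D2\<close> applies with
    \<open>A = centr E\<close>.\<close>
  have bound: "card S \<le> q * K" if E: "E \<subseteq> carrier G" "infinite (rad E)" and S: "separated (centr E) S" for E S
  proof -
    have "finite S" "S \<subseteq> carrier G" using S by (auto simp: separated_def)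
    from large[OF E(2) this] obtain R where R: "R \<in> rad E" "S \<subseteq> ball R" by blast
    have "D R \<subseteq> centr E" using R(1) D E(1) by (fastforce simp: rad_def centr_def)
    then show ?thesis using D2[OF _ subgroup_centr[OF E(1)]] R S by (auto simp: rad_def)
  qed
  \<comment> \<open>The condition \<open>card E < card S\<close> bounds the size of
    \<open>E\<close>: every element added to \<open>E\<close> has to be paid for by a further coset,
    and \<open>bound\<close> limits their number to \<open>q * K\<close>.\<close>
  define P where "P = (\<lambda>(E, S). E \<subseteq> carrier G \<and> finite E \<and> infinite (rad E) \<and> separated (centr E) S \<and> card E < card S)"
  have "rad {} = {R. good R}" by (simp add: rad_def)
  then have "P ({}, {\<one>})"
    using inf_good by (simp add: P_def separated_def)
  moreover have "\<forall>w. P w \<longrightarrow> card (snd w) < Suc (q * K)"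
    using bound by (auto simp: P_def le_imp_less_Suc)
  ultimately obtain w where w: "P w" "\<And>w'. P w' \<Longrightarrow> card (snd w') \<le> card (snd w)"
    using ex_has_greatest_nat[of P "({}, {\<one>})" "\<lambda>w. card (snd w)" "Suc (q * K)"] by metis
  obtain E S0 where ES: "w = (E, S0)" by (cases w)
  have E: "E \<subseteq> carrier G" "finite E" "infinite (rad E)" and S0: "separated (centr E) S0" "card E < card S0"
    using w(1) by (auto simp: P_def ES)
  have S0c: "S0 \<subseteq> carrier G" "finite S0" using S0(1) by (auto simp: separated_def)
  have stable: "g \<in> centr (centr E)" if g: "g \<in> carrier G" "infinite (rad (insert g E))" for g
  proof (rule ccontr)
    assume "g \<notin> centr (centr E)"
    then obtain a where a: "a \<in> centr E" "g \<otimes> a \<noteq> a \<otimes> g" using g(1) by (auto simp: centr_def)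
    have ac: "a \<in> carrier G" using a(1) by (simp add: centr_def)
    have "S0 \<noteq> {}" using S0(2) by (metis card.empty not_less_zero)
    then obtain s where s: "s \<in> S0" by blast
    have sc: "s \<in> carrier G" using s S0c by blast
    have sub: "centr (insert g E) \<subseteq> centr E" by (auto simp: centr_def)
    have notin: "a \<notin> centr (insert g E)" using a(2) by (auto simp: centr_def)
    have gE: "subgroup (centr (insert g E)) G" using g(1) E(1) by (intro subgroup_centr) auto
    \<comment> \<open>If \<open>g\<close> fails to commute with some \<open>a\<close> in
      \<open>centr E\<close>, adding \<open>g\<close> splits the coset of \<open>s\<close>:
      \<open>s\<close> and \<open>s \<otimes> a\<close> become separated, while the other elements
      of \<open>S0\<close> were separated from both already.\<close>
    have new: "inv t \<otimes> (s \<otimes> a) \<notin> centr (insert g E)" if t: "t \<in> S0" for t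
    proof
      assume ta: "inv t \<otimes> (s \<otimes> a) \<in> centr (insert g E)"
      have tc: "t \<in> carrier G" using t S0c by blast
      have "inv s \<otimes> (s \<otimes> a) = a" using sc ac by (simp add: m_assoc[symmetric])
      then have "inv (s \<otimes> a) \<otimes> s \<in> centr E"
        using a(1) sc ac left_rel_sym[OF subgroup_centr[OF E(1)], of s "s \<otimes> a"] by simp
      then have "inv t \<otimes> s \<in> centr E"
        using left_rel_trans[OF subgroup_centr[OF E(1)], of t "s \<otimes> a" s] ta sub tc sc ac by auto
      then have "t = s" using S0(1) s t by (auto simp: separated_def)
      then show False using ta notin \<open>inv s \<otimes> (s \<otimes> a) = a\<close> by simp
    qed
    have sep: "separated (centr (insert g E)) (insert (s \<otimes> a) S0)"
      using S0(1) sub sc ac new by (intro separated_insert[OF gE]) (auto simp: separated_def)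
    have "s \<otimes> a \<notin> S0"
    proof
      assume "s \<otimes> a \<in> S0"
      from new[OF this] show False using sc ac subgroup.one_closed[OF gE] by simp
    qed
    then have cd: "card (insert (s \<otimes> a) S0) = Suc (card S0)" using S0c by simp
    have "card (insert g E) \<le> Suc (card E)" by (rule card_insert_le_m1) auto
    then have "P (insert g E, insert (s \<otimes> a) S0)"
      using sep cd S0(2) g E by (auto simp: P_def)
    from w(2)[OF this] show False using cd by (simp add: ES)
  qed
  show thesis
  proof (rule that)
    show "card E \<le> q * K" using bound[OF E(1,3) S0(1)] S0(2) by simp
    fix S assume S: "separated (centr (centr E)) S"
    have finS: "finite S" and cS: "S \<subseteq> carrier G" using S by (auto simp: separated_def)
    show "card S \<le> q * (q * K) * K"
    proof (rule ccontr)
      assume big: "\<not> ?thesis"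
      define Q where "Q = {R \<in> rad E. S \<subseteq> ball R}"
      have "infinite Q"
      proof
        assume "finite Q"
        then have "infinite (rad E - Q)" using E(3) by (rule Diff_infinite_finite)
        from large[OF this finS cS] show False by (auto simp: Q_def)
      qed
      \<comment> \<open>A set larger than the bound is not separated modulo any of the groups
        \<open>centr (D R)\<close>, so each \<open>R\<close> in \<open>Q\<close> selects a pair from
        \<open>S\<close>. There are finitely many pairs, hence one is selected by infinitely many
        radii.\<close>
      define rel where "rel R = {(a, b) \<in> S \<times> S. a \<noteq> b \<and> inv a \<otimes> b \<in> centr (D R)}" for R
      have "\<exists>ab\<in>S \<times> S. ab \<in> rel R" if "R \<in> Q" for R
      proof (rule ccontr)
        assume "\<not> ?thesis"
        then have "separated (centr (D R)) S" using finS cS by (auto simp: separated_def rel_def)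
        then show False using D1[of R S] that big by (auto simp: Q_def rad_def)
      qed
      then have "Q \<subseteq> (\<Union>ab\<in>S \<times> S. {R \<in> Q. ab \<in> rel R})" by blast
      then have "\<exists>ab\<in>S \<times> S. infinite {R \<in> Q. ab \<in> rel R}"
        using \<open>infinite Q\<close> finS by (meson finite_SigmaI finite_UN_I finite_subset)
      then obtain a b where ab: "a \<in> S" "b \<in> S" "infinite {R \<in> Q. (a, b) \<in> rel R}" by blast
      then obtain R where "(a, b) \<in> rel R" using not_finite_existsD by blast
      then have "a \<noteq> b" by (simp add: rel_def)
      have "{R \<in> Q. (a, b) \<in> rel R} \<subseteq> rad (insert (inv a \<otimes> b) E)"
        by (auto simp: Q_def rel_def rad_def)
      then have "infinite (rad (insert (inv a \<otimes> b) E))" using ab(3) finite_subset by blast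
      then have "inv a \<otimes> b \<in> centr (centr E)" using ab cS by (intro stable) auto
      then show False using S ab(1,2) \<open>a \<noteq> b\<close> by (simp add: separated_def)
    qed
  qed (use E bound in auto)
qed

end

section \<open>Linear functionals and quantifier elimination over the integers\<close>

text \<open>These are affine functionals with integer coefficients. Parameters count as variables,
  so the functionals extracted from a formula do not change with the parameters; this is the source
  of all uniformity.\<close>

inductive_set lin :: "((nat \<Rightarrow> int) \<Rightarrow> int) set" where
  lin_const: "(\<lambda>e. c) \<in> lin"
| lin_var: "(\<lambda>e. e i) \<in> lin"
| lin_add: "f \<in> lin \<Longrightarrow> g \<in> lin \<Longrightarrow> (\<lambda>e. f e + g e) \<in> lin"
| lin_scale: "f \<in> lin \<Longrightarrow> (\<lambda>e. c * f e) \<in> lin"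

lemma lin_diff: "f \<in> lin \<Longrightarrow> g \<in> lin \<Longrightarrow> (\<lambda>e. f e - g e) \<in> lin"
  using lin_add[OF _ lin_scale[of g "- 1"], of f] by simp

lemma lin_update:
  assumes "l \<in> lin"
  shows "\<exists>c. \<forall>e a. l (e(x := a)) = c * a + l (e(x := 0))"
  using assms
proof induction
  case (lin_const c)
  show ?case by (intro exI[of _ 0]) simp
next
  case (lin_var i)
  show ?case by (intro exI[of _ "if i = x then 1 else 0"]) simp
next
  case (lin_add f g)
  then obtain c d where c: "\<And>e a. f (e(x := a)) = c * a + f (e(x := 0))"
    and d: "\<And>e a. g (e(x := a)) = d * a + g (e(x := 0))" by blast
  have "f (e(x := a)) + g (e(x := a)) = (c + d) * a + (f (e(x := 0)) + g (e(x := 0)))" for e a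
    unfolding c[of e a] d[of e a] by (simp add: algebra_simps)
  then show ?case by blast
next
  case (lin_scale f d)
  then obtain c where c: "\<And>e a. f (e(x := a)) = c * a + f (e(x := 0))" by blast
  have "d * f (e(x := a)) = (d * c) * a + d * f (e(x := 0))" for e a
    unfolding c[of e a] by (simp add: algebra_simps)
  then show ?case by blast
qed

lemma lin_restrict: "l \<in> lin \<Longrightarrow> (\<lambda>e. l (e(x := 0))) \<in> lin"
proof (induction rule: lin.induct)
  case (lin_var i)
  then show ?case using lin.lin_const[of 0] lin.lin_var[of i] by (cases "i = x") simp_all
qed (simp_all add: lin.intros)

lemma lin_cong:
  assumes "l \<in> lin" "\<And>i. [e i = e' i] (mod n)"
  shows "[l e = l e'] (mod n)"
  using assms(1) by induction (auto intro: cong_add cong_mult assms(2))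

text \<open>Classes of this relation play the role of complete quantifier-free descriptions: with
  finite \<open>L\<close> and positive \<open>N\<close>, a condition constant on them is a Boolean
  combination of inequalities and congruences.\<close>

definition equi :: "((nat \<Rightarrow> int) \<Rightarrow> int) set \<Rightarrow> int \<Rightarrow> (nat \<Rightarrow> int) \<Rightarrow> (nat \<Rightarrow> int) \<Rightarrow> bool" where
  "equi L N e e' \<longleftrightarrow> (\<forall>l\<in>L. 0 \<le> l e \<longleftrightarrow> 0 \<le> l e') \<and> (\<forall>i. [e i = e' i] (mod N))"

lemma equi_iff: "equi L N e e' \<Longrightarrow> l \<in> L \<Longrightarrow> 0 \<le> l e \<longleftrightarrow> 0 \<le> l e'"
  by (simp add: equi_def)

lemma equi_mono: "equi L' N' e e' \<Longrightarrow> L \<subseteq> L' \<Longrightarrow> N dvd N' \<Longrightarrow> equi L N e e'"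
  unfolding equi_def by (meson cong_dvd_modulus subsetD)

lemma equi_refl: "equi L N e e"
  by (simp add: equi_def)

lemma equi_trans: "equi L N e e' \<Longrightarrow> equi L N e' e'' \<Longrightarrow> equi L N e e''"
  unfolding equi_def by (meson cong_trans)

lemma equi_sym: "equi L N e e' \<Longrightarrow> equi L N e' e"
  unfolding equi_def by (meson cong_sym)

text \<open>After scaling, every inequality of \<open>L\<close> involving the variable \<open>x\<close> compares \<open>k x\<close>
  with one of finitely many boundary terms. An element further than the period away from all
  boundaries can be shifted by the period, so only elements near a boundary matter.\<close>

lemma scaled_inequality:
  fixes c :: int
  assumes "c \<noteq> 0" "k = \<bar>c\<bar> * r" "0 < r"
  shows "0 \<le> c * a + l \<longleftrightarrow> 0 \<le> sgn c * (k * a - (- sgn c * r * l))"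
proof -
  have "sgn c * (k * a - (- sgn c * r * l)) = r * (c * a + l)"
    using assms(1) unfolding assms(2) by (cases "0 < c") (simp_all add: algebra_simps)
  then show ?thesis using assms(3) by (simp add: zero_le_mult_iff)
qed

text \<open>The first property of \<open>L'\<close> and \<open>N'\<close> eliminates an existential
  quantifier. The second describes a witness that is alone in its class: it must lie near a
  boundary, and the same affine term then gives the witness, up to the factor \<open>k\<close>, for
  every equivalent assignment.\<close>

lemma elimination_step:
  assumes "finite L" "L \<subseteq> lin" "0 < N"
  obtains L' N' k B where "finite L'" "L' \<subseteq> lin" "0 < N'" "0 < (k::int)" "finite B" "B \<subseteq> lin"
    "\<And>e e' a. equi L' N' e e' \<Longrightarrow> \<exists>a'. equi L N (e(x := a)) (e'(x := a'))"
    "\<And>e a. (\<And>a'. equi L N (e(x := a)) (e(x := a')) \<Longrightarrow> a' = a) \<Longrightarrow>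
       \<exists>\<beta>\<in>B. \<forall>e'. equi L' N' e e' \<longrightarrow> (\<exists>a'. k * a' = \<beta> e' \<and> equi L N (e(x := a)) (e'(x := a')))"
proof -
  have "\<forall>l\<in>L. \<exists>c. \<forall>e a. l (e(x := a)) = c * a + l (e(x := 0))"
    using assms(2) lin_update by blast
  then obtain c where c: "\<And>l e a. l \<in> L \<Longrightarrow> l (e(x := a)) = c l * a + l (e(x := 0))"
    by metis
  define L1 where "L1 = {l \<in> L. c l \<noteq> 0}"
  have finL1: "finite L1" using assms(1) by (simp add: L1_def)
  \<comment> \<open>A common multiple of the coefficients of \<open>x\<close>, so that all
    inequalities become comparisons of \<open>k * a\<close> with boundaries
    \<open>b l e\<close>.\<close>
  define k where "k = (\<Prod>l\<in>L1. \<bar>c l\<bar>)"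
  have kpos: "0 < k" unfolding k_def by (rule prod_pos) (auto simp: L1_def)
  define r where "r l = k div \<bar>c l\<bar>" for l
  have kr: "k = \<bar>c l\<bar> * r l" if "l \<in> L1" for l
    using that finL1 dvd_prodI[of L1 l "\<lambda>l. \<bar>c l\<bar>"] by (simp add: r_def k_def)
  have rpos: "0 < r l" if "l \<in> L1" for l
  proof -
    have "0 < \<bar>c l\<bar> * r l" using kpos kr[OF that] by simp
    then show ?thesis by (rule zero_less_mult_pos) (use that in \<open>simp add: L1_def\<close>)
  qed
  define b where "b l e = - sgn (c l) * r l * l (e(x := 0))" for l and e :: "nat \<Rightarrow> int"
  have blin: "b l \<in> lin" if "l \<in> L1" for l
  proof -
    have "l \<in> lin" using that assms(2) by (auto simp: L1_def)
    from lin_scale[OF lin_restrict[OF this]] show ?thesis unfolding b_def .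
  qed
  have b_upd: "b l (e(x := a)) = b l e" for l e a by (simp add: b_def)
  have ineq: "0 \<le> l (e(x := a)) \<longleftrightarrow> 0 \<le> sgn (c l) * (k * a - b l e)" if "l \<in> L1" for l e a
    unfolding b_def using scaled_inequality[OF _ kr[OF that] rpos[OF that]] c[of l e a] that
    by (simp add: L1_def)
  \<comment> \<open>Moving \<open>a\<close> by one period \<open>N\<close> moves
    \<open>k * a\<close> by \<open>K\<close>.\<close>
  define K where "K = k * N"
  have Kpos: "0 < K" using kpos assms(3) by (simp add: K_def)
  define B where "B = (\<lambda>(l, j) e. b l e + j) ` (L1 \<times> {-K..K})"
  \<comment> \<open>The first part handles functionals not involving \<open>x\<close>; the second
    records how the boundaries are ordered, up to offsets that a point within \<open>K\<close> of a
    boundary can have.\<close>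
  define L' where "L' = (\<lambda>l e. l (e(x := 0))) ` L \<union> (\<lambda>(s, t, j) e. b s e - b t e + j) ` (L1 \<times> L1 \<times> {-K..K})"
  have finB: "finite B" and finL': "finite L'" using assms(1) finL1 by (simp_all add: B_def L'_def)
  have Blin: "B \<subseteq> lin" unfolding B_def using blin by (auto intro!: lin_add[OF _ lin_const])
  have L'lin: "L' \<subseteq> lin"
    unfolding L'_def using blin assms(2) by (auto intro!: lin_add[OF _ lin_const] lin_diff lin_restrict)
  have NK: "N dvd K" by (simp add: K_def)
  have L'_rest: "(\<lambda>e. l (e(x := 0))) \<in> L'" if "l \<in> L" for l
    unfolding L'_def using that by (intro UnI1 imageI)
  have L'_diff: "(\<lambda>e. b s e - b t e + j) \<in> L'" if "s \<in> L1" "t \<in> L1" "\<bar>j\<bar> \<le> K" for s t j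
    unfolding L'_def using that by (intro UnI2 image_eqI[of _ _ "(s, t, j)"]) auto
  have B_near: "(\<lambda>e. b s e + j) \<in> B" if "s \<in> L1" "\<bar>j\<bar> \<le> K" for s j
    unfolding B_def using that by (intro image_eqI[of _ _ "(s, j)"]) auto

  \<comment> \<open>Keep the offset \<open>j\<close> from the boundary. The boundary values agree
    modulo \<open>k * N\<close>, so \<open>b s e' + j\<close> is divisible by \<open>k\<close> and
    the quotient is congruent to \<open>a\<close> modulo \<open>N\<close>. Signs at the other
    boundaries are read off from \<open>L'\<close>.\<close>
  have near: "\<exists>a'. k * a' = b s e' + j \<and> equi L N (e(x := a)) (e'(x := a'))"
    if E: "equi L' K e e'" and s: "s \<in> L1" and j: "j = k * a - b s e" "\<bar>j\<bar> \<le> K" for e e' a s j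
  proof -
    have "[b s e' = b s e] (mod K)"
      using lin_cong[OF blin[OF s]] E cong_sym unfolding equi_def by metis
    then have "[b s e' + j = b s e + j] (mod K)" by (rule cong_add) simp
    then obtain w where w: "b s e' + j = k * a + K * w" using j(1) by (metis add.commute cong_iff_lin cong_sym diff_add_cancel)
    define a' where "a' = a + N * w"
    have ka': "k * a' = b s e' + j" using w by (simp add: a'_def K_def algebra_simps)
    have "[(e(x := a)) i = (e'(x := a')) i] (mod N)" for i
    proof (cases "i = x")
      case True
      then show ?thesis by (simp add: a'_def cong_iff_lin)
    next
      case False
      then show ?thesis using E cong_dvd_modulus[OF _ NK] unfolding equi_def by simp
    qed
    moreover have "0 \<le> l (e(x := a)) \<longleftrightarrow> 0 \<le> l (e'(x := a'))" if l: "l \<in> L" for l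
    proof (cases "c l = 0")
      case True
      have "0 \<le> l (e(x := 0)) \<longleftrightarrow> 0 \<le> l (e'(x := 0))" by (rule equi_iff[OF E L'_rest[OF l]])
      then show ?thesis using True by (simp only: c[OF l, of e a] c[OF l, of e' a']) simp
    next
      case False
      then have l1: "l \<in> L1" using l by (simp add: L1_def)
      have "0 \<le> b s e - b l e + j \<longleftrightarrow> 0 \<le> b s e' - b l e' + j"
        by (rule equi_iff[OF E L'_diff[OF s l1 j(2)]])
      moreover have "0 \<le> b l e - b s e + (- j) \<longleftrightarrow> 0 \<le> b l e' - b s e' + (- j)"
        by (rule equi_iff[OF E L'_diff[OF l1 s]]) (use j(2) in simp)
      ultimately show ?thesis unfolding ineq[OF l1] ka' using j(1) False
        by (cases "c l > 0") (auto simp: sgn_if)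
    qed
    ultimately show ?thesis using ka' unfolding equi_def by blast
  qed

  have shift: "equi L N (e(x := a)) (e(x := a + N * d))"
    if far: "\<And>s. s \<in> L1 \<Longrightarrow> K < \<bar>k * a - b s e\<bar>" and d: "\<bar>d\<bar> = 1" for e a d
  proof -
    have Kd: "k * (a + N * d) = k * a + K * d" by (simp add: K_def algebra_simps)
    have Kd1: "K * d = K \<or> K * d = - K" using d by (auto simp: abs_if split: if_splits)
    have "0 \<le> l (e(x := a)) \<longleftrightarrow> 0 \<le> l (e(x := a + N * d))" if l: "l \<in> L" for l
    proof (cases "c l = 0")
      case True
      then show ?thesis by (simp only: c[OF l, of e a] c[OF l, of e "a + N * d"]) simp
    next
      case False
      then have l1: "l \<in> L1" using l by (simp add: L1_def)
      show ?thesis unfolding ineq[OF l1] Kd using far[OF l1] Kd1 Kpos False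
        by (cases "c l > 0") (auto simp: sgn_if)
    qed
    then show ?thesis by (simp add: equi_def cong_iff_lin)
  qed

  \<comment> \<open>Walk towards the boundary \<open>b s\<close> by periods; until some boundary is
    within \<open>K\<close>, no step changes the class.\<close>
  have approach: "\<exists>a'. equi L N (e(x := a)) (e'(x := a'))"
    if E: "equi L' K e e'" and s: "s \<in> L1" for e e' a s
  proof (induction "nat \<bar>k * a - b s e\<bar>" arbitrary: a rule: less_induct)
    case less
    show ?case
    proof (cases "\<exists>t\<in>L1. \<bar>k * a - b t e\<bar> \<le> K")
      case True
      then show ?thesis using near[OF E] by blast
    next
      case False
      define u where "u = k * a - b s e"
      define d where "d = - sgn u"
      have far: "K < \<bar>u\<bar>" using False s by (force simp: u_def)
      then have d: "\<bar>d\<bar> = 1" using Kpos by (auto simp: d_def sgn_if)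
      have "k * (a + N * d) - b s e = u + K * d" by (simp add: K_def u_def algebra_simps)
      moreover have "\<bar>u + K * d\<bar> < \<bar>u\<bar>" using far Kpos by (auto simp: d_def sgn_if)
      ultimately have "nat \<bar>k * (a + N * d) - b s e\<bar> < nat \<bar>u\<bar>"
        by (metis abs_ge_zero nat_less_eq_zless)
      then have "nat \<bar>k * (a + N * d) - b s e\<bar> < nat \<bar>k * a - b s e\<bar>" by (simp only: u_def)
      from less[OF this] obtain a' where "equi L N (e(x := a + N * d)) (e'(x := a'))" by blast
      moreover have "equi L N (e(x := a)) (e(x := a + N * d))"
        by (rule shift[OF _ d]) (use False in \<open>simp add: not_le\<close>)
      ultimately show ?thesis using equi_trans by blast
    qed
  qed

  show thesis
  proof (rule that[OF finL' L'lin Kpos kpos finB Blin])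
    fix e e' a assume E: "equi L' K e e'"
    show "\<exists>a'. equi L N (e(x := a)) (e'(x := a'))"
    proof (cases "L1 = {}")
      case True
      then have c0: "l \<in> L \<Longrightarrow> c l = 0" for l by (auto simp: L1_def)
      have "0 \<le> l (e(x := a)) \<longleftrightarrow> 0 \<le> l (e'(x := a))" if l: "l \<in> L" for l
      proof -
        have "0 \<le> l (e(x := 0)) \<longleftrightarrow> 0 \<le> l (e'(x := 0))" by (rule equi_iff[OF E L'_rest[OF l]])
        then show ?thesis using c0[OF l] by (simp only: c[OF l, of e a] c[OF l, of e' a]) simp
      qed
      moreover have "[(e(x := a)) i = (e'(x := a)) i] (mod N)" for i
        using E cong_dvd_modulus[OF _ NK] unfolding equi_def by simp
      ultimately show ?thesis unfolding equi_def by blast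
    next
      case False
      then obtain s where "s \<in> L1" by blast
      then show ?thesis by (rule approach[OF E])
    qed
  next
    fix e a assume uniq: "\<And>a'. equi L N (e(x := a)) (e(x := a')) \<Longrightarrow> a' = a"
    \<comment> \<open>Far from all boundaries, \<open>a + N\<close> would be a second element of the
      same class.\<close>
    have "\<exists>s\<in>L1. \<bar>k * a - b s e\<bar> \<le> K"
    proof (rule ccontr)
      assume "\<not> ?thesis"
      then have "equi L N (e(x := a)) (e(x := a + N * 1))"
        by (intro shift) (simp_all add: not_le)
      from uniq[OF this] show False using assms(3) by simp
    qed
    then obtain s where s: "s \<in> L1" "\<bar>k * a - b s e\<bar> \<le> K" by blast
    define j where "j = k * a - b s e"
    have "(\<lambda>e. b s e + j) \<in> B" using s by (intro B_near) (simp_all add: j_def)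
    then show "\<exists>\<beta>\<in>B. \<forall>e'. equi L' K e e' \<longrightarrow> (\<exists>a'. k * a' = \<beta> e' \<and> equi L N (e(x := a)) (e'(x := a')))"
      using near[OF _ s(1) j_def] s(2)[folded j_def] by (intro bexI[of _ "\<lambda>e. b s e + j"]) metis
  qed
qed

section \<open>Quantifier elimination in semantic form\<close>

definition simple :: "((nat \<Rightarrow> int) \<Rightarrow> bool) \<Rightarrow> bool" where
  "simple P \<longleftrightarrow> (\<exists>L N. finite L \<and> L \<subseteq> lin \<and> 0 < N \<and> (\<forall>e e'. equi L N e e' \<longrightarrow> P e = P e'))"

lemma simpleI:
  "finite L \<Longrightarrow> L \<subseteq> lin \<Longrightarrow> 0 < N \<Longrightarrow> (\<And>e e'. equi L N e e' \<Longrightarrow> P e \<Longrightarrow> P e') \<Longrightarrow> simple P"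
  unfolding simple_def using equi_sym by (intro exI[of _ L] exI[of _ N]) blast

lemma simple_ex:
  assumes "simple P"
  shows "simple (\<lambda>e. \<exists>a. P (e(x := a)))"
proof -
  obtain L N where L: "finite L" "L \<subseteq> lin" "0 < N" "\<And>e e'. equi L N e e' \<Longrightarrow> P e = P e'"
    using assms unfolding simple_def by blast
  show ?thesis
  proof (rule elimination_step[OF L(1-3)], rule simpleI)
    fix L' N' and e e' :: "nat \<Rightarrow> int"
    assume step: "\<And>e e' a. equi L' N' e e' \<Longrightarrow> \<exists>a'. equi L N (e(x := a)) (e'(x := a'))"
      and E: "equi L' N' e e'" and "\<exists>a. P (e(x := a))"
    then obtain a where "P (e(x := a))" by blast
    moreover obtain a' where "equi L N (e(x := a)) (e'(x := a'))" using step[OF E] by blast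
    ultimately show "\<exists>a. P (e'(x := a))" using L(4) by blast
  qed
qed

lemma simple_conj:
  assumes "simple P" "simple Q"
  shows "simple (\<lambda>e. P e \<and> Q e)"
proof -
  obtain L N where L: "finite L" "L \<subseteq> lin" "0 < N" "\<And>e e'. equi L N e e' \<Longrightarrow> P e = P e'"
    using assms(1) unfolding simple_def by blast
  obtain L' N' where L': "finite L'" "L' \<subseteq> lin" "0 < N'" "\<And>e e'. equi L' N' e e' \<Longrightarrow> Q e = Q e'"
    using assms(2) unfolding simple_def by blast
  show ?thesis
  proof (rule simpleI[of "L \<union> L'" "N * N'"])
    fix e e' assume "equi (L \<union> L') (N * N') e e'" "P e \<and> Q e"
    then show "P e' \<and> Q e'"
      using L(4)[OF equi_mono] L'(4)[OF equi_mono] by (metis Un_upper1 Un_upper2 dvd_triv_left dvd_triv_right)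
  qed (use L L' in auto)
qed

lemma teval_lin: "(\<lambda>e. teval Zstr e t) \<in> lin"
proof (induction t)
  case (Var i)
  show ?case by (simp add: lin_var)
next
  case Zero
  show ?case by (simp add: lin_const)
next
  case One
  show ?case by (simp add: lin_const)
next
  case (Add s t)
  then show ?case using lin_add[OF Add] by (simp add: Zstr_def)
next
  case (Sub s t)
  then show ?case using lin_diff[OF Sub] by (simp add: Zstr_def)
qed

lemma simple_holds: "simple (holds Zstr \<phi>)"
proof (induction \<phi>)
  case FFalse
  show ?case unfolding simple_def by (intro exI[of _ "{}"] exI[of _ 1]) simp
next
  case (Eq s t)
  let ?L = "{\<lambda>e. teval Zstr e s - teval Zstr e t, \<lambda>e. teval Zstr e t - teval Zstr e s}"
  show ?case unfolding simple_def
    by (intro exI[of _ ?L] exI[of _ 1]) (auto simp: equi_def intro!: lin_diff teval_lin)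
next
  case (Less s t)
  let ?L = "{\<lambda>e. teval Zstr e s - teval Zstr e t}"
  have "plt Zstr a b \<longleftrightarrow> \<not> 0 \<le> a - b" for a b by (auto simp: Zstr_def)
  then show ?case unfolding simple_def
    by (intro exI[of _ ?L] exI[of _ 1]) (auto simp: equi_def intro!: lin_diff teval_lin)
next
  case (Cong n s t)
  show ?case
  \<comment> \<open>Congruence modulo 0 is equality, so it is expressed by two inequalities; the
    other moduli need only residues.\<close>
  proof (cases "n = 0")
    case True
    let ?L = "{\<lambda>e. teval Zstr e s - teval Zstr e t, \<lambda>e. teval Zstr e t - teval Zstr e s}"
    have "pcong Zstr n a b \<longleftrightarrow> a = b" for a b using True by (simp add: Zstr_def)
    then show ?thesis unfolding simple_def
      by (intro exI[of _ ?L] exI[of _ 1]) (auto simp: equi_def intro!: lin_diff teval_lin)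
  next
    case False
    have "holds Zstr (Cong n s t) e = holds Zstr (Cong n s t) e'" if "equi {} (int n) e e'" for e e'
    proof -
      have "[teval Zstr e u = teval Zstr e' u] (mod int n)" for u
        using lin_cong[OF teval_lin] that unfolding equi_def by blast
      moreover have "pcong Zstr n a b \<longleftrightarrow> [a = b] (mod int n)" for a b by (simp add: Zstr_def)
      ultimately show ?thesis by simp (meson cong_sym cong_trans)
    qed
    then show ?thesis unfolding simple_def
      using False by (intro exI[of _ "{}"] exI[of _ "int n"]) auto
  qed
next
  case (Neg \<phi>)
  then show ?case by (simp add: simple_def)
next
  case (Conj \<phi> \<psi>)
  then show ?case using simple_conj by simp
next
  case (Ex x \<phi>)
  then show ?case using simple_ex by simp
qed

section \<open>Formulas over blocks of variables\<close>

fun tren :: "(nat \<Rightarrow> nat) \<Rightarrow> pterm \<Rightarrow> pterm" where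
  "tren r (Var i) = Var (r i)"
| "tren r Zero = Zero"
| "tren r One = One"
| "tren r (Add s t) = Add (tren r s) (tren r t)"
| "tren r (Sub s t) = Sub (tren r s) (tren r t)"

fun ren :: "(nat \<Rightarrow> nat) \<Rightarrow> pform \<Rightarrow> pform" where
  "ren r FFalse = FFalse"
| "ren r (Eq s t) = Eq (tren r s) (tren r t)"
| "ren r (Less s t) = Less (tren r s) (tren r t)"
| "ren r (Cong n s t) = Cong n (tren r s) (tren r t)"
| "ren r (Neg \<phi>) = Neg (ren r \<phi>)"
| "ren r (Conj \<phi> \<psi>) = Conj (ren r \<phi>) (ren r \<psi>)"
| "ren r (Ex x \<phi>) = Ex (r x) (ren r \<phi>)"

lemma teval_tren: "teval M e (tren r t) = teval M (\<lambda>i. e (r i)) t"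
  by (induction t) auto

text \<open>Bound variables are renamed together with the free ones, so injectivity of
  \<open>r\<close> rules out capture without choosing fresh variables.\<close>

lemma holds_ren: "inj r \<Longrightarrow> holds M (ren r \<phi>) e = holds M \<phi> (\<lambda>i. e (r i))"
proof (induction \<phi> arbitrary: e)
  case (Ex x \<phi>)
  have "(\<lambda>i. (e(r x := a)) (r i)) = (\<lambda>i. e (r i))(x := a)" for a
    using Ex.prems by (auto simp: inj_eq)
  then show ?case using Ex by simp
qed (auto simp: teval_tren)

lemma finite_fvars: "finite (fvars \<phi>)"
proof -
  have "finite (tvars t)" for t by (induction t) auto
  then show ?thesis by (induction \<phi>) auto
qed

fun exs :: "nat list \<Rightarrow> pform \<Rightarrow> pform" where
  "exs [] \<phi> = \<phi>"
| "exs (x # xs) \<phi> = Ex x (exs xs \<phi>)"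

lemma holds_exs:
  "holds M (exs vs \<phi>) e \<longleftrightarrow> (\<exists>e'. (\<forall>v. v \<notin> set vs \<longrightarrow> e' v = e v) \<and> holds M \<phi> e')"
proof (induction vs arbitrary: e)
  case Nil
  have "(\<forall>v. e' v = e v) \<longleftrightarrow> e' = e" for e' by auto
  then show ?case by simp
next
  case (Cons x vs)
  have "(\<exists>a. \<forall>v. v \<notin> set vs \<longrightarrow> e' v = (e(x := a)) v) \<longleftrightarrow> (\<forall>v. v \<notin> set (x # vs) \<longrightarrow> e' v = e v)" for e'
    by (auto intro: exI[of _ "e' x"])
  moreover have "holds M (exs (x # vs) \<phi>) e \<longleftrightarrow>
      (\<exists>e'. (\<exists>a. \<forall>v. v \<notin> set vs \<longrightarrow> e' v = (e(x := a)) v) \<and> holds M \<phi> e')"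
    unfolding exs.simps holds.simps Cons.IH by blast
  ultimately show ?case by simp
qed

lemma fvars_exs: "fvars (exs vs \<phi>) = fvars \<phi> - set vs"
  by (induction vs) auto

text \<open>\<open>presburger_model\<close> speaks of sentences only. A formula valid under all
  integer assignments is transferred through its universal closure, so parameters in
  \<open>M\<close> may be nonstandard.\<close>

lemma presburger_transfer:
  assumes "presburger_model M" "\<And>e. holds Zstr \<phi> e"
  shows "holds M \<phi> e"
proof -
  obtain vs where vs: "set vs = fvars \<phi>" using finite_list[OF finite_fvars] by blast
  have "sentence (Neg (exs vs (Neg \<phi>)))" by (simp add: sentence_def fvars_exs vs)
  moreover have "holds Zstr (Neg (exs vs (Neg \<phi>))) e" for e using assms(2) by (simp add: holds_exs)
  ultimately have "holds M (Neg (exs vs (Neg \<phi>))) e"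
    using assms(1) unfolding presburger_model_def by blast
  then show ?thesis by (auto simp: holds_exs)
qed

definition imp :: "pform \<Rightarrow> pform \<Rightarrow> pform" where
  "imp \<phi> \<psi> = Neg (Conj \<phi> (Neg \<psi>))"

definition conjs :: "pform list \<Rightarrow> pform" where
  "conjs \<phi>s = foldr Conj \<phi>s (Neg FFalse)"

definition disjs :: "pform list \<Rightarrow> pform" where
  "disjs \<phi>s = Neg (conjs (map Neg \<phi>s))"

lemma holds_imp [simp]: "holds M (imp \<phi> \<psi>) e \<longleftrightarrow> (holds M \<phi> e \<longrightarrow> holds M \<psi> e)"
  by (simp add: imp_def)

lemma holds_conjs [simp]: "holds M (conjs \<phi>s) e \<longleftrightarrow> (\<forall>\<phi>\<in>set \<phi>s. holds M \<phi> e)"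
  by (induction \<phi>s) (auto simp: conjs_def)

lemma holds_disjs [simp]: "holds M (disjs \<phi>s) e \<longleftrightarrow> (\<exists>\<phi>\<in>set \<phi>s. holds M \<phi> e)"
  by (simp add: disjs_def)

lemma holds_conjs_upt: "holds M (conjs (map f [0..<n])) e \<longleftrightarrow> (\<forall>i<n. holds M (f i) e)"
  by (simp add: atLeast0LessThan) (simp add: Ball_def)

lemma holds_disjs_pairs:
  "holds M (disjs (concat (map (\<lambda>j. map (\<lambda>i. f i j) [0..<j]) [0..<n]))) e \<longleftrightarrow> (\<exists>j<n. \<exists>i<j. holds M (f i j) e)"
proof -
  have "set (concat (map (\<lambda>j. map (\<lambda>i. f i j) [0..<j]) [0..<n])) = (\<Union>j\<in>{..<n}. (\<lambda>i. f i j) ` {..<j})"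
    by (simp add: atLeast0LessThan)
  then show ?thesis unfolding holds_disjs
    by (simp only: bex_UN bex_simps(7)) (simp add: Bex_def)
qed

text \<open>Variables are arranged in blocks via \<open>prod_encode\<close>: for \<open>b > 0\<close>, block \<open>b\<close> holds an
  \<open>m\<close>-tuple in its first \<open>m\<close> places; block \<open>0\<close> holds the parameters,
  those of the carrier at even and those of the multiplication at odd places.\<close>

definition tup :: "nat \<Rightarrow> (nat \<Rightarrow> 'a) \<Rightarrow> nat \<Rightarrow> 'a list" where
  "tup m e b = map (\<lambda>i. e (prod_encode (b, i))) [0..<m]"

definition params :: "(nat \<Rightarrow> 'a) \<Rightarrow> nat \<Rightarrow> 'a" where
  "params e i = e (prod_encode (0, i))"

definition setb :: "nat \<Rightarrow> nat set \<Rightarrow> (nat \<Rightarrow> 'a list) \<Rightarrow> (nat \<Rightarrow> 'a) \<Rightarrow> nat \<Rightarrow> 'a" where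
  "setb m B X e n = (case prod_decode n of (b, i) \<Rightarrow> if b \<in> B \<and> i < m then X b ! i else e n)"

definition exb :: "nat \<Rightarrow> nat list \<Rightarrow> pform \<Rightarrow> pform" where
  "exb m bs \<phi> = exs (map prod_encode (List.product bs [0..<m])) \<phi>"

definition allb :: "nat \<Rightarrow> nat list \<Rightarrow> pform \<Rightarrow> pform" where
  "allb m bs \<phi> = Neg (exb m bs (Neg \<phi>))"

lemma length_tup [simp]: "length (tup m e b) = m"
  by (simp add: tup_def)

lemma nth_tup: "i < m \<Longrightarrow> tup m e b ! i = e (prod_encode (b, i))"
  by (simp add: tup_def)

lemma tup_setb:
  "(\<And>b. b \<in> B \<Longrightarrow> length (X b) = m) \<Longrightarrow> tup m (setb m B X e) b = (if b \<in> B then X b else tup m e b)"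
  by (auto simp: tup_def setb_def intro: nth_equalityI)

lemma params_setb: "0 \<notin> B \<Longrightarrow> params (setb m B X e) = params e"
  by (auto simp: params_def setb_def fun_eq_iff)

lemma holds_exb:
  "holds M (exb m bs \<phi>) e \<longleftrightarrow> (\<exists>X. (\<forall>b. length (X b) = m) \<and> holds M \<phi> (setb m (set bs) X e))"
proof
  assume "holds M (exb m bs \<phi>) e"
  then obtain e' where e': "\<And>v. v \<notin> prod_encode ` (set bs \<times> {..<m}) \<Longrightarrow> e' v = e v" "holds M \<phi> e'"
    by (auto simp: exb_def holds_exs lessThan_atLeast0)
  have "e' n = setb m (set bs) (tup m e') e n" for n
  proof (cases "prod_decode n")
    case (Pair b i)
    then have n: "n = prod_encode (b, i)" by (metis prod_decode_inverse)
    then show ?thesis using e'(1)[of n] inj_prod_encode[of UNIV]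
      by (auto simp: setb_def nth_tup inj_image_mem_iff)
  qed
  then have "e' = setb m (set bs) (tup m e') e" by blast
  then show "\<exists>X. (\<forall>b. length (X b) = m) \<and> holds M \<phi> (setb m (set bs) X e)"
    using e'(2) by (metis length_tup)
next
  assume "\<exists>X. (\<forall>b. length (X b) = m) \<and> holds M \<phi> (setb m (set bs) X e)"
  then obtain X where "holds M \<phi> (setb m (set bs) X e)" by blast
  moreover have "setb m (set bs) X e v = e v" if "v \<notin> prod_encode ` (set bs \<times> {..<m})" for v
    using that by (auto simp: setb_def image_iff split: prod.splits) (metis prod_decode_inverse lessThan_iff)
  ultimately show "holds M (exb m bs \<phi>) e"
    by (auto simp: exb_def holds_exs lessThan_atLeast0)
qed

lemma holds_exb1:
  "holds M (exb m [b] \<phi>) e \<longleftrightarrow> (\<exists>x. length x = m \<and> holds M \<phi> (setb m {b} (\<lambda>_. x) e))"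
proof -
  have "setb m {b} X e = setb m {b} (\<lambda>_. X b) e" for X
    by (auto simp: setb_def fun_eq_iff split: prod.splits)
  then show ?thesis unfolding holds_exb by (metis list.set(1,2))
qed

lemma holds_allb:
  "holds M (allb m bs \<phi>) e \<longleftrightarrow> (\<forall>X. (\<forall>b. length (X b) = m) \<longrightarrow> holds M \<phi> (setb m (set bs) X e))"
  by (auto simp: allb_def holds_exb)

lemma holds_allb1:
  "holds M (allb m [b] \<phi>) e \<longleftrightarrow> (\<forall>x. length x = m \<longrightarrow> holds M \<phi> (setb m {b} (\<lambda>_. x) e))"
  by (auto simp: allb_def holds_exb1)

definition eqb :: "nat \<Rightarrow> nat \<Rightarrow> nat \<Rightarrow> pform" where
  "eqb m a b = conjs (map (\<lambda>i. Eq (Var (prod_encode (a, i))) (Var (prod_encode (b, i)))) [0..<m])"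

lemma holds_eqb [simp]: "holds M (eqb m a b) e \<longleftrightarrow> tup m e a = tup m e b"
  by (auto simp: eqb_def tup_def)

section \<open>Definable groups as pairs of formulas, and first-order statements about them\<close>

definition car :: "'a pstruct \<Rightarrow> nat \<Rightarrow> pform \<Rightarrow> (nat \<Rightarrow> 'a) \<Rightarrow> 'a list set" where
  "car M m \<phi> p = {xs. length xs = m \<and> holds M \<phi> (\<lambda>i. if i < m then xs ! i else p (2 * i))}"

definition mulr :: "'a pstruct \<Rightarrow> nat \<Rightarrow> pform \<Rightarrow> (nat \<Rightarrow> 'a) \<Rightarrow> 'a list \<Rightarrow> 'a list \<Rightarrow> 'a list \<Rightarrow> bool" where
  "mulr M m \<psi> p xs ys zs \<longleftrightarrow>
     holds M \<psi> (\<lambda>i. if i < 3 * m then (xs @ ys @ zs) ! i else p (2 * i + 1))"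

definition carF :: "nat \<Rightarrow> pform \<Rightarrow> nat \<Rightarrow> pform" where
  "carF m \<phi> b = ren (\<lambda>i. prod_encode (if i < m then (b, i) else (0, 2 * i))) \<phi>"

definition mulF :: "nat \<Rightarrow> pform \<Rightarrow> nat \<Rightarrow> nat \<Rightarrow> nat \<Rightarrow> pform" where
  "mulF m \<psi> a b c = ren (\<lambda>i. prod_encode (if i < m then (a, i) else if i < 2 * m then (b, i - m)
     else if i < 3 * m then (c, i - 2 * m) else (0, 2 * i + 1))) \<psi>"

lemma holds_carF: "0 < b \<Longrightarrow> holds M (carF m \<phi> b) e \<longleftrightarrow> tup m e b \<in> car M m \<phi> (params e)"
proof -
  assume "0 < b"
  then have "inj (\<lambda>i. prod_encode (if i < m then (b, i) else (0, 2 * i)))"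
    by (auto intro!: injI split: if_splits)
  moreover have "(\<lambda>i. e (prod_encode (if i < m then (b, i) else (0, 2 * i)))) =
    (\<lambda>i. if i < m then tup m e b ! i else params e (2 * i))"
    by (auto simp: nth_tup params_def)
  ultimately show ?thesis by (simp add: carF_def car_def holds_ren)
qed

lemma holds_mulF:
  assumes "0 < a" "0 < b" "0 < c" "a \<noteq> b" "a \<noteq> c" "b \<noteq> c"
  shows "holds M (mulF m \<psi> a b c) e \<longleftrightarrow> mulr M m \<psi> (params e) (tup m e a) (tup m e b) (tup m e c)"
proof -
  let ?r = "\<lambda>i. prod_encode (if i < m then (a, i) else if i < 2 * m then (b, i - m)
     else if i < 3 * m then (c, i - 2 * m) else (0, 2 * i + 1))"
  have "inj ?r" using assms by (auto intro!: injI split: if_splits)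
  moreover have "(\<lambda>i. e (?r i)) =
    (\<lambda>i. if i < 3 * m then (tup m e a @ tup m e b @ tup m e c) ! i else params e (2 * i + 1))"
    by (intro ext) (auto simp: nth_tup params_def nth_append diff_diff_left mult_2)
  ultimately show ?thesis by (simp add: mulF_def mulr_def holds_ren)
qed

lemma car_length: "x \<in> car M m \<phi> p \<Longrightarrow> length x = m"
  by (simp add: car_def)

text \<open>The axioms speak of the graph of the multiplication so that they can be written as a
  formula; a left unit with left inverses is enough for \<open>groupI\<close>.\<close>

definition group_axioms_on :: "nat \<Rightarrow> 'a list set \<Rightarrow> ('a list \<Rightarrow> 'a list \<Rightarrow> 'a list \<Rightarrow> bool) \<Rightarrow> bool" where
  "group_axioms_on m A mu \<longleftrightarrow>
     (\<forall>x y z. length x = m \<longrightarrow> length y = m \<longrightarrow> length z = m \<longrightarrow> mu x y z \<longrightarrow> x \<in> A \<and> y \<in> A \<and> z \<in> A) \<and>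
     (\<forall>x\<in>A. \<forall>y\<in>A. \<exists>z\<in>A. mu x y z) \<and>
     (\<forall>x\<in>A. \<forall>y\<in>A. \<forall>z\<in>A. \<forall>z'\<in>A. mu x y z \<longrightarrow> mu x y z' \<longrightarrow> z = z') \<and>
     (\<forall>x\<in>A. \<forall>y\<in>A. \<forall>z\<in>A. \<forall>u\<in>A. \<forall>v\<in>A. \<forall>w\<in>A. \<forall>w'\<in>A.
        mu x y u \<longrightarrow> mu u z w \<longrightarrow> mu y z v \<longrightarrow> mu x v w' \<longrightarrow> w = w') \<and>
     (\<exists>o1\<in>A. (\<forall>x\<in>A. \<forall>y\<in>A. mu o1 x y \<longrightarrow> y = x) \<and> (\<forall>x\<in>A. \<exists>y\<in>A. mu y x o1))"

definition allc :: "nat \<Rightarrow> pform \<Rightarrow> nat \<Rightarrow> pform \<Rightarrow> pform" where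
  "allc m \<phi> b \<chi> = allb m [b] (imp (carF m \<phi> b) \<chi>)"

definition exc :: "nat \<Rightarrow> pform \<Rightarrow> nat \<Rightarrow> pform \<Rightarrow> pform" where
  "exc m \<phi> b \<chi> = exb m [b] (Conj (carF m \<phi> b) \<chi>)"

lemma holds_allc: "0 < b \<Longrightarrow> holds M (allc m \<phi> b \<chi>) e \<longleftrightarrow>
    (\<forall>x\<in>car M m \<phi> (params e). holds M \<chi> (setb m {b} (\<lambda>_. x) e))"
  by (auto simp: allc_def holds_allb1 holds_carF tup_setb params_setb dest: car_length)

lemma holds_exc: "0 < b \<Longrightarrow> holds M (exc m \<phi> b \<chi>) e \<longleftrightarrow>
    (\<exists>x\<in>car M m \<phi> (params e). holds M \<chi> (setb m {b} (\<lambda>_. x) e))"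
  by (simp add: exc_def holds_exb1 holds_carF tup_setb params_setb Bex_def cong: conj_cong)
    (blast dest: car_length)

definition groupF :: "nat \<Rightarrow> pform \<Rightarrow> pform \<Rightarrow> pform" where
  "groupF m \<phi> \<psi> = conjs [
     allb m [1] (allb m [2] (allb m [3]
       (imp (mulF m \<psi> 1 2 3) (conjs [carF m \<phi> 1, carF m \<phi> 2, carF m \<phi> 3])))),
     allc m \<phi> 1 (allc m \<phi> 2 (exc m \<phi> 3 (mulF m \<psi> 1 2 3))),
     allc m \<phi> 1 (allc m \<phi> 2 (allc m \<phi> 3 (allc m \<phi> 4
       (imp (mulF m \<psi> 1 2 3) (imp (mulF m \<psi> 1 2 4) (eqb m 3 4)))))),
     allc m \<phi> 1 (allc m \<phi> 2 (allc m \<phi> 3 (allc m \<phi> 4 (allc m \<phi> 5 (allc m \<phi> 6 (allc m \<phi> 7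
       (imp (mulF m \<psi> 1 2 4) (imp (mulF m \<psi> 4 3 6) (imp (mulF m \<psi> 2 3 5) (imp (mulF m \<psi> 1 5 7) (eqb m 6 7))))))))))),
     exc m \<phi> 1 (Conj (allc m \<phi> 2 (allc m \<phi> 3 (imp (mulF m \<psi> 1 2 3) (eqb m 3 2))))
       (allc m \<phi> 2 (exc m \<phi> 3 (mulF m \<psi> 3 2 1))))]"

lemma holds_groupF:
  "holds M (groupF m \<phi> \<psi>) e \<longleftrightarrow> group_axioms_on m (car M m \<phi> (params e)) (mulr M m \<psi> (params e))"
  by (simp add: groupF_def group_axioms_on_def holds_allb1 holds_allc holds_exc holds_carF holds_mulF
      tup_setb params_setb car_length cong: ball_cong bex_cong)

definition commutes_in :: "'a list set \<Rightarrow> ('a list \<Rightarrow> 'a list \<Rightarrow> 'a list \<Rightarrow> bool) \<Rightarrow> 'a list \<Rightarrow> 'a list \<Rightarrow> bool" where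
  "commutes_in A mu x y \<longleftrightarrow> (\<exists>w\<in>A. mu x y w \<and> mu y x w)"

definition bicentral :: "'a list set \<Rightarrow> ('a list \<Rightarrow> 'a list \<Rightarrow> 'a list \<Rightarrow> bool) \<Rightarrow> nat \<Rightarrow> (nat \<Rightarrow> 'a list) \<Rightarrow> 'a list \<Rightarrow> bool" where
  "bicentral A mu r E u \<longleftrightarrow> (\<forall>k<r. commutes_in A mu u (E k)) \<and>
     (\<forall>v\<in>A. (\<forall>k<r. commutes_in A mu v (E k)) \<longrightarrow> commutes_in A mu u v)"

text \<open>In a group, \<open>bicentral\<close> means lying in C(E) and in C(C(E)), that is, in the
  center of C(E). The index bound is a pigeonhole statement: among \<open>N + 1\<close> elements,
  two lie in the same left coset.\<close>

definition bounded_index :: "'a list set \<Rightarrow> ('a list \<Rightarrow> 'a list \<Rightarrow> 'a list \<Rightarrow> bool) \<Rightarrow> nat \<Rightarrow> nat \<Rightarrow> (nat \<Rightarrow> 'a list) \<Rightarrow> bool" where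
  "bounded_index A mu r N E \<longleftrightarrow> (\<forall>k<r. E k \<in> A) \<and>
     (\<forall>g. (\<forall>i\<le>N. g i \<in> A) \<longrightarrow> (\<exists>j\<le>N. \<exists>i<j. \<exists>u\<in>A. mu (g i) u (g j) \<and> bicentral A mu r E u))"

definition commF :: "nat \<Rightarrow> pform \<Rightarrow> pform \<Rightarrow> nat \<Rightarrow> nat \<Rightarrow> pform" where
  "commF m \<phi> \<psi> a b = exc m \<phi> 3 (Conj (mulF m \<psi> a b 3) (mulF m \<psi> b a 3))"

definition bicentralF :: "nat \<Rightarrow> pform \<Rightarrow> pform \<Rightarrow> nat \<Rightarrow> pform" where
  "bicentralF m \<phi> \<psi> r = Conj (conjs (map (\<lambda>k. commF m \<phi> \<psi> 1 (10 + k)) [0..<r]))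
     (allc m \<phi> 2 (imp (conjs (map (\<lambda>k. commF m \<phi> \<psi> 2 (10 + k)) [0..<r])) (commF m \<phi> \<psi> 1 2)))"

text \<open>The blocks \<open>10 + k\<close> hold \<open>E\<close>, the blocks from
  \<open>10 + r\<close> on hold the \<open>N + 1\<close> test elements; the offset 10 keeps both
  clear of the working blocks 1, 2 and 3.\<close>

definition indexF :: "nat \<Rightarrow> pform \<Rightarrow> pform \<Rightarrow> nat \<Rightarrow> nat \<Rightarrow> pform" where
  "indexF m \<phi> \<psi> r N = Conj (conjs (map (\<lambda>k. carF m \<phi> (10 + k)) [0..<r]))
     (allb m (map (\<lambda>i. 10 + r + i) [0..<Suc N])
       (imp (conjs (map (\<lambda>i. carF m \<phi> (10 + r + i)) [0..<Suc N]))
         (disjs (concat (map (\<lambda>j. map (\<lambda>i. exc m \<phi> 1 (Conj (mulF m \<psi> (10 + r + i) 1 (10 + r + j))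
            (bicentralF m \<phi> \<psi> r))) [0..<j]) [0..<Suc N])))))"

lemma holds_commF:
  "\<lbrakk>0 < a; 0 < b; a \<noteq> b; a \<noteq> 3; b \<noteq> 3\<rbrakk> \<Longrightarrow> holds M (commF m \<phi> \<psi> a b) e \<longleftrightarrow>
    commutes_in (car M m \<phi> (params e)) (mulr M m \<psi> (params e)) (tup m e a) (tup m e b)"
  by (simp add: commF_def commutes_in_def holds_exc holds_mulF tup_setb params_setb car_length cong: bex_cong)

lemma holds_bicentralF:
  "holds M (bicentralF m \<phi> \<psi> r) e \<longleftrightarrow>
    bicentral (car M m \<phi> (params e)) (mulr M m \<psi> (params e)) r (\<lambda>k. tup m e (10 + k)) (tup m e 1)"
  by (simp add: bicentralF_def bicentral_def holds_allc holds_commF tup_setb params_setb car_length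
      atLeast0LessThan Ball_def[of "{..<r}"] cong: ball_cong)

lemma holds_indexF:
  "holds M (indexF m \<phi> \<psi> r N) e \<longleftrightarrow>
    bounded_index (car M m \<phi> (params e)) (mulr M m \<psi> (params e)) r N (\<lambda>k. tup m e (10 + k))"
proof -
  let ?A = "car M m \<phi> (params e)" and ?mu = "mulr M m \<psi> (params e)"
  let ?E = "\<lambda>k. tup m e (10 + k)" and ?B = "(\<lambda>i. 10 + r + i) ` {..N}"
  let ?W = "\<lambda>i j. exc m \<phi> 1 (Conj (mulF m \<psi> (10 + r + i) 1 (10 + r + j)) (bicentralF m \<phi> \<psi> r))"
  let ?S = "\<lambda>g. \<exists>j\<le>N. \<exists>i<j. \<exists>u\<in>?A. ?mu (g i) u (g j) \<and> bicentral ?A ?mu r ?E u"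
  have outer: "holds M (indexF m \<phi> \<psi> r N) e \<longleftrightarrow> (\<forall>k<r. ?E k \<in> ?A) \<and>
      (\<forall>X. (\<forall>b. length (X b) = m) \<longrightarrow> (\<forall>i\<le>N. X (10 + r + i) \<in> ?A) \<longrightarrow> ?S (\<lambda>i. X (10 + r + i)))"
  proof -
    have "holds M (exc m \<phi> 1 (Conj (mulF m \<psi> (10 + r + i) 1 (10 + r + j)) (bicentralF m \<phi> \<psi> r))) (setb m ?B X e)
       \<longleftrightarrow> (\<exists>u\<in>?A. ?mu (X (10 + r + i)) u (X (10 + r + j)) \<and> bicentral ?A ?mu r ?E u)"
      if "\<forall>b. length (X b) = m" "j \<le> N" "i < j" for X i j
    proof -
      have "bicentral ?A ?mu r (\<lambda>k. tup m (setb m {1} (\<lambda>_. u) (setb m ?B X e)) (10 + k)) u \<longleftrightarrow>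
        bicentral ?A ?mu r ?E u" if "length u = m" for u
      proof -
        have "tup m (setb m {1} (\<lambda>_. u) (setb m ?B X e)) (10 + k) = ?E k" if "k < r" for k
          using \<open>\<forall>b. length (X b) = m\<close> \<open>length u = m\<close> that by (auto simp: tup_setb)
        then show ?thesis by (simp add: bicentral_def)
      qed
      then show ?thesis using that
        by (simp add: holds_exc holds_mulF holds_bicentralF tup_setb params_setb image_iff car_length cong: bex_cong)
    qed
    note inner = this
    have set_blocks: "set (map (\<lambda>i. 10 + r + i) [0..<Suc N]) = ?B"
      by (simp only: set_map set_upt atLeast0LessThan lessThan_Suc_atMost)
    have "holds M (imp (conjs (map (\<lambda>i. carF m \<phi> (10 + r + i)) [0..<Suc N]))
        (disjs (concat (map (\<lambda>j. map (\<lambda>i. ?W i j) [0..<j]) [0..<Suc N])))) (setb m ?B X e) \<longleftrightarrow>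
        ((\<forall>i\<le>N. X (10 + r + i) \<in> ?A) \<longrightarrow> ?S (\<lambda>i. X (10 + r + i)))"
      if X: "\<forall>b. length (X b) = m" for X
    proof -
      have tups: "holds M (carF m \<phi> (10 + r + i)) (setb m ?B X e) \<longleftrightarrow> X (10 + r + i) \<in> ?A" if "i \<le> N" for i
        using X that by (simp add: holds_carF tup_setb params_setb image_iff)
      then have "(\<forall>i\<le>N. holds M (carF m \<phi> (10 + r + i)) (setb m ?B X e)) \<longleftrightarrow> (\<forall>i\<le>N. X (10 + r + i) \<in> ?A)"
        by blast
      moreover have "(\<exists>j\<le>N. \<exists>i<j. holds M (?W i j) (setb m ?B X e)) \<longleftrightarrow> ?S (\<lambda>i. X (10 + r + i))"
        using inner[OF X] by meson
      ultimately show ?thesis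
        unfolding holds_imp holds_conjs_upt holds_disjs_pairs less_Suc_eq_le by (rule arg_cong2)
    qed
    then show ?thesis
      unfolding indexF_def holds.simps holds_allb set_blocks by (auto simp: holds_carF)
  qed
  have "(\<forall>X. (\<forall>b. length (X b) = m) \<longrightarrow> (\<forall>i\<le>N. X (10 + r + i) \<in> ?A) \<longrightarrow> ?S (\<lambda>i. X (10 + r + i))) \<longleftrightarrow>
     (\<forall>g. (\<forall>i\<le>N. g i \<in> ?A) \<longrightarrow> ?S g)" (is "?L \<longleftrightarrow> ?R")
  proof
    assume L: ?L
    show ?R
    proof (intro allI impI)
      fix g assume g: "\<forall>i\<le>N. g i \<in> ?A"
      \<comment> \<open>Every block needs a tuple of length \<open>m\<close>: truncated subtraction
        assigns \<open>g 0\<close> to the blocks below \<open>10 + r\<close>, and a dummy tuple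
        fills those past the sequence.\<close>
      define X where "X b = (if b - (10 + r) \<le> N then g (b - (10 + r)) else replicate m undefined)" for b
      have "\<forall>b. length (X b) = m" using g car_length by (fastforce simp: X_def)
      moreover have Xg: "X (10 + r + i) = g i" if "i \<le> N" for i using that by (simp add: X_def)
      moreover have "\<forall>i\<le>N. X (10 + r + i) \<in> ?A" using g Xg by simp
      ultimately have "?S (\<lambda>i. X (10 + r + i))" using L by blast
      then obtain j i u where *: "j \<le> N" "i < j" "u \<in> ?A" "?mu (X (10 + r + i)) u (X (10 + r + j))"
        "bicentral ?A ?mu r ?E u" by blast
      moreover have "X (10 + r + i) = g i" "X (10 + r + j) = g j" using Xg *(1,2) by simp_all
      ultimately show "?S g" by metis
    qed
  next
    assume ?R
    then show ?L by simp
  qed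
  then show ?thesis unfolding outer bounded_index_def by blast
qed

section \<open>Density of separated sets\<close>

lemma pigeonhole_fibre:
  assumes "finite X" "f ` X \<subseteq> U" "finite U" "U \<noteq> {}"
  shows "\<exists>u\<in>U. card X \<le> card U * card {x \<in> X. f x = u}"
proof (rule ccontr)
  assume "\<not> ?thesis"
  then have small: "card U * card {x \<in> X. f x = u} < card X" if "u \<in> U" for u
    using that by (simp add: not_le)
  have "X = (\<Union>u\<in>U. {x \<in> X. f x = u})" using assms(2) by auto
  then have "card X \<le> (\<Sum>u\<in>U. card {x \<in> X. f x = u})"
    using card_UN_le[OF assms(3), of "\<lambda>u. {x \<in> X. f x = u}"] by simp
  then have "card U * card X \<le> (\<Sum>u\<in>U. card U * card {x \<in> X. f x = u})"
    unfolding sum_distrib_left[symmetric] by (rule mult_le_mono2)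
  also have "\<dots> < (\<Sum>u\<in>U. card X)" using assms(3,4) small by (rule sum_strict_mono)
  finally show False by simp
qed

text \<open>Take the largest value \<open>b\<close> of \<open>f\<close> with at least half of
  \<open>X\<close> at or above it. If fewer than half were at or below \<open>b\<close>, the next
  larger value would still qualify. Both halves contain the ties at \<open>b\<close>.\<close>

lemma median:
  fixes f :: "'x \<Rightarrow> int"
  assumes "finite X"
  obtains b where "card X \<le> 2 * card {x \<in> X. b \<le> f x}" "card X \<le> 2 * card {x \<in> X. f x \<le> b}"
proof (cases "X = {}")
  case False
  define S where "S = {b \<in> f ` X. card X \<le> 2 * card {x \<in> X. b \<le> f x}}"
  have fin: "finite S" using assms by (simp add: S_def)
  have "{x \<in> X. Min (f ` X) \<le> f x} = X" using assms by auto
  then have "Min (f ` X) \<in> S" using assms False by (simp add: S_def)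
  then have "S \<noteq> {}" by blast
  define b where "b = Max S"
  have b: "b \<in> S" unfolding b_def using fin \<open>S \<noteq> {}\<close> by (rule Max_in)
  have "card X \<le> 2 * card {x \<in> X. f x \<le> b}"
  proof (rule ccontr)
    assume small: "\<not> ?thesis"
    let ?T = "{x \<in> X. b < f x}"
    have "card X = card {x \<in> X. f x \<le> b} + card ?T"
      using assms by (subst card_Un_disjoint[symmetric]) (auto intro: arg_cong[where f = card])
    then have big: "card X \<le> 2 * card ?T" "?T \<noteq> {}" using small by (auto simp del: Collect_empty_eq)
    define b' where "b' = Min (f ` ?T)"
    have b': "b' \<in> f ` ?T" unfolding b'_def using assms big(2) by (intro Min_in) auto
    have "?T \<subseteq> {x \<in> X. b' \<le> f x}" using assms by (auto simp: b'_def)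
    then have "card ?T \<le> card {x \<in> X. b' \<le> f x}" using assms by (intro card_mono) auto
    then have "b' \<in> S" using b' big(1) by (auto simp: S_def)
    then have "b' \<le> b" unfolding b_def using fin by (rule Max_ge[rotated])
    then show False using b' by auto
  qed
  then show thesis using that b by (auto simp: S_def)
qed (use that in auto)

text \<open>The sign at the three medians decides: if it is nonnegative, it stays so on the three
  upper halves, otherwise it stays negative on the three lower halves.\<close>

lemma split_sign:
  fixes f :: "'x \<Rightarrow> int" and g :: "'y \<Rightarrow> int" and h :: "'z \<Rightarrow> int"
  assumes "finite X" "finite Y" "finite Z"
  shows "\<exists>X'\<subseteq>X. \<exists>Y'\<subseteq>Y. \<exists>Z'\<subseteq>Z. card X \<le> 2 * card X' \<and> card Y \<le> 2 * card Y' \<and> card Z \<le> 2 * card Z' \<and>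
    (\<exists>s. \<forall>x\<in>X'. \<forall>y\<in>Y'. \<forall>z\<in>Z'. (0 \<le> f x + g y + h z + c) = s)"
proof -
  obtain a where a: "card X \<le> 2 * card {x \<in> X. a \<le> f x}" "card X \<le> 2 * card {x \<in> X. f x \<le> a}"
    using median[OF assms(1)] by blast
  obtain b where b: "card Y \<le> 2 * card {y \<in> Y. b \<le> g y}" "card Y \<le> 2 * card {y \<in> Y. g y \<le> b}"
    using median[OF assms(2)] by blast
  obtain d where d: "card Z \<le> 2 * card {z \<in> Z. d \<le> h z}" "card Z \<le> 2 * card {z \<in> Z. h z \<le> d}"
    using median[OF assms(3)] by blast
  show ?thesis
  proof (cases "0 \<le> a + b + d + c")
    case True
    then have "\<forall>x\<in>{x \<in> X. a \<le> f x}. \<forall>y\<in>{y \<in> Y. b \<le> g y}. \<forall>z\<in>{z \<in> Z. d \<le> h z}. (0 \<le> f x + g y + h z + c) = True"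
      by auto
    with a(1) b(1) d(1) show ?thesis
      by (intro exI[of _ "{x \<in> X. a \<le> f x}"] exI[of _ "{y \<in> Y. b \<le> g y}"] exI[of _ "{z \<in> Z. d \<le> h z}"]
          conjI exI[of _ True]) simp_all
  next
    case False
    then have "\<forall>x\<in>{x \<in> X. f x \<le> a}. \<forall>y\<in>{y \<in> Y. g y \<le> b}. \<forall>z\<in>{z \<in> Z. h z \<le> d}. (0 \<le> f x + g y + h z + c) = False"
      by auto
    with a(2) b(2) d(2) show ?thesis
      by (intro exI[of _ "{x \<in> X. f x \<le> a}"] exI[of _ "{y \<in> Y. g y \<le> b}"] exI[of _ "{z \<in> Z. h z \<le> d}"]
          conjI exI[of _ False]) simp_all
  qed
qed

lemma split_signs:
  fixes f :: "'l \<Rightarrow> 'x \<Rightarrow> int" and g :: "'l \<Rightarrow> 'y \<Rightarrow> int" and h :: "'l \<Rightarrow> 'z \<Rightarrow> int"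
  assumes "finite L" "finite X" "finite Y" "finite Z"
  shows "\<exists>X'\<subseteq>X. \<exists>Y'\<subseteq>Y. \<exists>Z'\<subseteq>Z.
    card X \<le> 2 ^ card L * card X' \<and> card Y \<le> 2 ^ card L * card Y' \<and> card Z \<le> 2 ^ card L * card Z' \<and>
    (\<forall>l\<in>L. \<exists>s. \<forall>x\<in>X'. \<forall>y\<in>Y'. \<forall>z\<in>Z'. (0 \<le> f l x + g l y + h l z + c l) = s)"
  using assms(1)
proof (induction L rule: finite_induct)
  case empty
  show ?case by (intro exI[of _ X] exI[of _ Y] exI[of _ Z] conjI) simp_all
next
  case (insert l L)
  then obtain X1 Y1 Z1 where 1: "X1 \<subseteq> X" "Y1 \<subseteq> Y" "Z1 \<subseteq> Z"
    "card X \<le> 2 ^ card L * card X1" "card Y \<le> 2 ^ card L * card Y1" "card Z \<le> 2 ^ card L * card Z1"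
    and sL: "\<forall>l\<in>L. \<exists>s. \<forall>x\<in>X1. \<forall>y\<in>Y1. \<forall>z\<in>Z1. (0 \<le> f l x + g l y + h l z + c l) = s"
    by (elim exE conjE) (rule that)
  have fin: "finite X1" "finite Y1" "finite Z1" by (rule finite_subset[OF 1(1) assms(2)], rule finite_subset[OF 1(2) assms(3)],
      rule finite_subset[OF 1(3) assms(4)])
  obtain X2 Y2 Z2 where 2: "X2 \<subseteq> X1" "Y2 \<subseteq> Y1" "Z2 \<subseteq> Z1"
    "card X1 \<le> 2 * card X2" "card Y1 \<le> 2 * card Y2" "card Z1 \<le> 2 * card Z2"
    and sl: "\<exists>s. \<forall>x\<in>X2. \<forall>y\<in>Y2. \<forall>z\<in>Z2. (0 \<le> f l x + g l y + h l z + c l) = s"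
    using split_sign[OF fin, of "f l" "g l" "h l" "c l"] by (elim exE conjE) (rule that, assumption+, rule exI)
  have c: "k \<le> 2 ^ card (insert l L) * j" if "k \<le> 2 ^ card L * i" "i \<le> 2 * j" for i j k :: nat
  proof -
    have "2 ^ card L * i \<le> 2 ^ card L * (2 * j)" using that(2) by (rule mult_le_mono2)
    with that(1) have "k \<le> 2 ^ card L * (2 * j)" by (rule le_trans)
    then show ?thesis using insert.hyps by (simp add: ac_simps)
  qed
  have "\<forall>k\<in>insert l L. \<exists>s. \<forall>x\<in>X2. \<forall>y\<in>Y2. \<forall>z\<in>Z2. (0 \<le> f k x + g k y + h k z + c k) = s"
  proof
    fix k assume k: "k \<in> insert l L"
    show "\<exists>s. \<forall>x\<in>X2. \<forall>y\<in>Y2. \<forall>z\<in>Z2. (0 \<le> f k x + g k y + h k z + c k) = s"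
    proof (cases "k = l")
      case True
      then show ?thesis using sl by simp
    next
      case False
      then have "k \<in> L" using k by simp
      from bspec[OF sL this] obtain s
        where s: "\<forall>x\<in>X1. \<forall>y\<in>Y1. \<forall>z\<in>Z1. (0 \<le> f k x + g k y + h k z + c k) = s" ..
      show ?thesis
      proof (intro exI ballI)
        fix x y z assume "x \<in> X2" "y \<in> Y2" "z \<in> Z2"
        then have "x \<in> X1" "y \<in> Y1" "z \<in> Z1" using 2(1-3) by auto
        then show "(0 \<le> f k x + g k y + h k z + c k) = s" by (rule s[rule_format])
      qed
    qed
  qed
  moreover have "X2 \<subseteq> X" "Y2 \<subseteq> Y" "Z2 \<subseteq> Z" using 1(1-3) 2(1-3) by auto
  ultimately show ?case using c[OF 1(4) 2(4)] c[OF 1(5) 2(5)] c[OF 1(6) 2(6)]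
    by (intro exI[of _ X2] exI[of _ Y2] exI[of _ Z2] conjI)
qed

section \<open>Norms, residue classes and separable functionals\<close>

definition norm1 :: "int list \<Rightarrow> int" where
  "norm1 x = (\<Sum>a\<leftarrow>x. \<bar>a\<bar>)"

lemma norm1_nonneg: "0 \<le> norm1 x"
  unfolding norm1_def by (induction x) auto

lemma nth_le_norm1: "i < length x \<Longrightarrow> \<bar>x ! i\<bar> \<le> norm1 x"
proof (induction x arbitrary: i)
  case (Cons a x)
  then show ?case using norm1_nonneg[of x] by (cases i) (fastforce simp: norm1_def)+
qed simp

lemma norm1_le: "(\<And>i. i < length x \<Longrightarrow> \<bar>x ! i\<bar> \<le> t i) \<Longrightarrow> norm1 x \<le> (\<Sum>i<length x. t i)"
  unfolding norm1_def sum_list_sum_nth by (auto simp: atLeast0LessThan intro: sum_mono)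

lemma ball_norm1:
  fixes R m :: nat
  defines "Q \<equiv> {x. length x = m \<and> norm1 x \<le> int R}"
  shows "finite Q" "card Q \<le> (2 * R + 1) ^ m"
proof -
  have sub: "Q \<subseteq> {x. set x \<subseteq> {- int R..int R} \<and> length x = m}"
  proof safe
    fix x a assume x: "x \<in> Q" "a \<in> set x"
    then obtain i where "i < length x" "a = x ! i" by (metis in_set_conv_nth)
    then have "\<bar>a\<bar> \<le> int R" using nth_le_norm1[of i x] x(1) by (auto simp: Q_def)
    then show "a \<in> {- int R..int R}" by auto
  qed (simp add: Q_def)
  have fin: "finite {x. set x \<subseteq> {- int R..int R} \<and> length x = m}" by (rule finite_lists_length_eq) simp
  show "finite Q" using sub fin by (rule finite_subset)
  have "card Q \<le> card {x. set x \<subseteq> {- int R..int R} \<and> length x = m}" using fin sub by (rule card_mono)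
  also have "\<dots> = (2 * R + 1) ^ m" by (subst card_lists_length_eq) (simp_all add: nat_add_distrib nat_mult_distrib)
  finally show "card Q \<le> (2 * R + 1) ^ m" .
qed

lemma same_residues:
  assumes "finite X" "\<And>x. x \<in> X \<Longrightarrow> length x = m" "0 < N"
  obtains X' where "X' \<subseteq> X" "card X \<le> nat N ^ m * card X'"
    "\<And>x y i. x \<in> X' \<Longrightarrow> y \<in> X' \<Longrightarrow> i < m \<Longrightarrow> [x ! i = y ! i] (mod N)"
proof -
  let ?f = "map (\<lambda>a. a mod N)" and ?U = "{x. set x \<subseteq> {0..<N} \<and> length x = m}"
  have "finite ?U" by (rule finite_lists_length_eq) simp
  moreover have "?f ` X \<subseteq> ?U" using assms(2,3) by auto
  moreover have "replicate m 0 \<in> ?U" using assms(3) by auto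
  then have "?U \<noteq> {}" by blast
  moreover have "card ?U = nat N ^ m" by (subst card_lists_length_eq) simp_all
  ultimately obtain u where u: "card X \<le> nat N ^ m * card {x \<in> X. ?f x = u}"
    using pigeonhole_fibre[of X ?f ?U] assms(1) by auto
  have "[x ! i = y ! i] (mod N)" if "x \<in> {x \<in> X. ?f x = u}" "y \<in> {x \<in> X. ?f x = u}" "i < m" for x y i
  proof -
    have "?f x = ?f y" "length x = m" "length y = m" using that assms(2) by simp_all
    then show ?thesis unfolding cong_def using that(3) by (metis nth_map)
  qed
  then show thesis using u by (intro that[of "{x \<in> X. ?f x = u}"]) auto
qed

definition env3 :: "nat \<Rightarrow> (nat \<Rightarrow> 'a) \<Rightarrow> 'a list \<Rightarrow> 'a list \<Rightarrow> 'a list \<Rightarrow> nat \<Rightarrow> 'a" where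
  "env3 m e x y z = setb m {1, 2, 3} (\<lambda>b. if b = 1 then x else if b = 2 then y else z) e"

lemma env3_apply: "env3 m e x y z (prod_encode (b, i)) =
  (if b = 1 \<and> i < m then x ! i else if b = 2 \<and> i < m then y ! i else if b = 3 \<and> i < m then z ! i
   else e (prod_encode (b, i)))"
  by (auto simp: env3_def setb_def)

text \<open>The order of quantifiers matters: \<open>C\<close> depends on the coefficients of
  \<open>l\<close> only, whereas the values of the parameters are absorbed into the constant
  \<open>c\<close>, chosen after \<open>e\<close>.\<close>

lemma lin_separable:
  assumes "l \<in> lin"
  shows "\<exists>C. 0 \<le> C \<and> (\<forall>e. \<exists>f g h c.
    (\<forall>x. length x = m \<longrightarrow> \<bar>f x\<bar> \<le> C * norm1 x \<and> \<bar>g x\<bar> \<le> C * norm1 x \<and> \<bar>h x\<bar> \<le> C * norm1 x) \<and>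
    (\<forall>x y z. l (env3 m e x y z) = f x + g y + h z + c))"
  using assms
proof induction
  case (lin_const c)
  show ?case by (intro exI[of _ 0] conjI allI exI[of _ "\<lambda>_. 0"] exI[of _ c]) simp_all
next
  case (lin_var n)
  obtain b i where n: "n = prod_encode (b, i)" by (metis prod_decode_inverse surj_pair)
  let ?P = "\<lambda>a x. if b = a \<and> i < m then x ! i else 0"
  show ?case
  proof (intro exI[of _ 1] conjI allI)
    fix e :: "nat \<Rightarrow> int"
    show "\<exists>f g h c. (\<forall>x. length x = m \<longrightarrow> \<bar>f x\<bar> \<le> 1 * norm1 x \<and> \<bar>g x\<bar> \<le> 1 * norm1 x \<and> \<bar>h x\<bar> \<le> 1 * norm1 x) \<and>
      (\<forall>x y z. env3 m e x y z n = f x + g y + h z + c)"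
      using nth_le_norm1 norm1_nonneg
      by (intro exI[of _ "?P 1"] exI[of _ "?P 2"] exI[of _ "?P 3"]
          exI[of _ "if (b = 1 \<or> b = 2 \<or> b = 3) \<and> i < m then 0 else e n"]) (auto simp: n env3_apply)
  qed simp
next
  case (lin_add l l')
  then obtain C C' where C: "0 \<le> C" "0 \<le> C'" and
    s: "\<forall>e. \<exists>f g h c. (\<forall>x. length x = m \<longrightarrow> \<bar>f x\<bar> \<le> C * norm1 x \<and> \<bar>g x\<bar> \<le> C * norm1 x \<and> \<bar>h x\<bar> \<le> C * norm1 x) \<and>
      (\<forall>x y z. l (env3 m e x y z) = f x + g y + h z + c)" and
    s': "\<forall>e. \<exists>f g h c. (\<forall>x. length x = m \<longrightarrow> \<bar>f x\<bar> \<le> C' * norm1 x \<and> \<bar>g x\<bar> \<le> C' * norm1 x \<and> \<bar>h x\<bar> \<le> C' * norm1 x) \<and>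
      (\<forall>x y z. l' (env3 m e x y z) = f x + g y + h z + c)" by blast
  show ?case
  proof (intro exI[of _ "C + C'"] conjI allI)
    fix e :: "nat \<Rightarrow> int"
    obtain f g h c where 1: "\<forall>x. length x = m \<longrightarrow> \<bar>f x\<bar> \<le> C * norm1 x \<and> \<bar>g x\<bar> \<le> C * norm1 x \<and> \<bar>h x\<bar> \<le> C * norm1 x"
      "\<forall>x y z. l (env3 m e x y z) = f x + g y + h z + c" using s by blast
    obtain f' g' h' c' where 2: "\<forall>x. length x = m \<longrightarrow> \<bar>f' x\<bar> \<le> C' * norm1 x \<and> \<bar>g' x\<bar> \<le> C' * norm1 x \<and> \<bar>h' x\<bar> \<le> C' * norm1 x"
      "\<forall>x y z. l' (env3 m e x y z) = f' x + g' y + h' z + c'" using s' by blast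
    have add: "\<bar>a + a'\<bar> \<le> (C + C') * n" if "\<bar>a\<bar> \<le> C * n" "\<bar>a'\<bar> \<le> C' * n" for a a' n :: int
      using that by (simp add: distrib_right)
    show "\<exists>f g h c. (\<forall>x. length x = m \<longrightarrow> \<bar>f x\<bar> \<le> (C + C') * norm1 x \<and> \<bar>g x\<bar> \<le> (C + C') * norm1 x \<and> \<bar>h x\<bar> \<le> (C + C') * norm1 x) \<and>
      (\<forall>x y z. l (env3 m e x y z) + l' (env3 m e x y z) = f x + g y + h z + c)"
      using 1 2 add by (intro exI[of _ "\<lambda>x. f x + f' x"] exI[of _ "\<lambda>x. g x + g' x"]
          exI[of _ "\<lambda>x. h x + h' x"] exI[of _ "c + c'"]) simp
  qed (use C in simp)
next
  case (lin_scale l d)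
  then obtain C where C: "0 \<le> C" and
    s: "\<forall>e. \<exists>f g h c. (\<forall>x. length x = m \<longrightarrow> \<bar>f x\<bar> \<le> C * norm1 x \<and> \<bar>g x\<bar> \<le> C * norm1 x \<and> \<bar>h x\<bar> \<le> C * norm1 x) \<and>
      (\<forall>x y z. l (env3 m e x y z) = f x + g y + h z + c)" by blast
  show ?case
  proof (intro exI[of _ "\<bar>d\<bar> * C"] conjI allI)
    fix e :: "nat \<Rightarrow> int"
    obtain f g h c where 1: "\<forall>x. length x = m \<longrightarrow> \<bar>f x\<bar> \<le> C * norm1 x \<and> \<bar>g x\<bar> \<le> C * norm1 x \<and> \<bar>h x\<bar> \<le> C * norm1 x"
      "\<forall>x y z. l (env3 m e x y z) = f x + g y + h z + c" using s by blast
    have mul: "\<bar>d * a\<bar> \<le> \<bar>d\<bar> * C * n" if "\<bar>a\<bar> \<le> C * n" for a n :: int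
      using mult_left_mono[OF that, of "\<bar>d\<bar>"] by (simp add: abs_mult mult.assoc)
    show "\<exists>f g h c. (\<forall>x. length x = m \<longrightarrow> \<bar>f x\<bar> \<le> \<bar>d\<bar> * C * norm1 x \<and> \<bar>g x\<bar> \<le> \<bar>d\<bar> * C * norm1 x \<and> \<bar>h x\<bar> \<le> \<bar>d\<bar> * C * norm1 x) \<and>
      (\<forall>x y z. d * l (env3 m e x y z) = f x + g y + h z + c)"
      using 1 mul by (intro exI[of _ "\<lambda>x. d * f x"] exI[of _ "\<lambda>x. d * g x"]
          exI[of _ "\<lambda>x. d * h x"] exI[of _ "d * c"]) (simp add: distrib_left)
  qed (use C in simp)
qed

lemma group_of_axioms:
  assumes ax: "group_axioms_on m A mu" and len: "\<And>x. x \<in> A \<Longrightarrow> length x = m"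
  obtains G :: "'a list monoid" where "group G" "carrier G = A"
    "\<And>x y z. length x = m \<Longrightarrow> length y = m \<Longrightarrow> length z = m \<Longrightarrow>
       mu x y z \<longleftrightarrow> x \<in> A \<and> y \<in> A \<and> z = x \<otimes>\<^bsub>G\<^esub> y"
proof -
  have mem: "\<And>x y z. length x = m \<Longrightarrow> length y = m \<Longrightarrow> length z = m \<Longrightarrow> mu x y z \<Longrightarrow> x \<in> A \<and> y \<in> A \<and> z \<in> A"
    and tot: "\<And>x y. x \<in> A \<Longrightarrow> y \<in> A \<Longrightarrow> \<exists>z\<in>A. mu x y z"
    and uniq: "\<And>x y z z'. x \<in> A \<Longrightarrow> y \<in> A \<Longrightarrow> z \<in> A \<Longrightarrow> z' \<in> A \<Longrightarrow> mu x y z \<Longrightarrow> mu x y z' \<Longrightarrow> z = z'"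
    and assoc: "\<And>x y z u v w w'. x \<in> A \<Longrightarrow> y \<in> A \<Longrightarrow> z \<in> A \<Longrightarrow> u \<in> A \<Longrightarrow> v \<in> A \<Longrightarrow> w \<in> A \<Longrightarrow> w' \<in> A \<Longrightarrow>
      mu x y u \<Longrightarrow> mu u z w \<Longrightarrow> mu y z v \<Longrightarrow> mu x v w' \<Longrightarrow> w = w'"
    using ax unfolding group_axioms_on_def by blast+
  have "\<exists>o1\<in>A. (\<forall>x\<in>A. \<forall>y\<in>A. mu o1 x y \<longrightarrow> y = x) \<and> (\<forall>x\<in>A. \<exists>y\<in>A. mu y x o1)"
    using ax unfolding group_axioms_on_def by (elim conjE)
  then obtain o1 where o1: "o1 \<in> A" "\<And>x y. x \<in> A \<Longrightarrow> y \<in> A \<Longrightarrow> mu o1 x y \<Longrightarrow> y = x" "\<And>x. x \<in> A \<Longrightarrow> \<exists>y\<in>A. mu y x o1"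
    by auto
  define f where "f x y = (SOME z. z \<in> A \<and> mu x y z)" for x y
  have f: "f x y \<in> A \<and> mu x y (f x y)" if "x \<in> A" "y \<in> A" for x y
    using someI_ex[of "\<lambda>z. z \<in> A \<and> mu x y z"] tot[OF that] unfolding f_def by blast
  define G where "G = \<lparr>carrier = A, monoid.mult = f, one = o1\<rparr>"
  have "group G"
  proof (rule groupI)
    fix x y z assume "x \<in> carrier G" "y \<in> carrier G" "z \<in> carrier G"
    then have "x \<in> A" "y \<in> A" "z \<in> A" by (simp_all add: G_def)
    then have "f (f x y) z = f x (f y z)"
      using assoc[of x y z "f x y" "f y z" "f (f x y) z" "f x (f y z)"] f by metis
    then show "x \<otimes>\<^bsub>G\<^esub> y \<otimes>\<^bsub>G\<^esub> z = x \<otimes>\<^bsub>G\<^esub> (y \<otimes>\<^bsub>G\<^esub> z)" by (simp add: G_def)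
  next
    fix x assume x: "x \<in> carrier G"
    then obtain y where y: "y \<in> A" "mu y x o1" using o1(3) by (auto simp: G_def)
    then have "f y x = o1" using uniq f o1(1) x by (metis G_def partial_object.select_convs(1))
    then show "\<exists>y\<in>carrier G. y \<otimes>\<^bsub>G\<^esub> x = \<one>\<^bsub>G\<^esub>" using y by (auto simp: G_def)
  qed (use f o1 in \<open>auto simp: G_def\<close>)
  moreover have "mu x y z \<longleftrightarrow> x \<in> A \<and> y \<in> A \<and> z = x \<otimes>\<^bsub>G\<^esub> y" if "length x = m" "length y = m" "length z = m" for x y z
    using mem[OF that] uniq f[of x y] by (auto simp: G_def)
  ultimately show thesis by (intro that[of G]) (simp_all add: G_def)
qed

section \<open>Groups definable over the integers\<close>

text \<open>The graph of the coordinate as a function of blocks 1, 2 and 3, with the value in place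
  0 of block 4; blocks 5 and 6 hold the partial and the full product.\<close>

definition prodF :: "nat \<Rightarrow> pform \<Rightarrow> nat \<Rightarrow> pform" where
  "prodF m \<psi> j = exb m [5] (Conj (mulF m \<psi> 1 2 5) (exb m [6] (Conj (mulF m \<psi> 5 3 6)
     (Eq (Var (prod_encode (6, j))) (Var (prod_encode (4, 0)))))))"

lemma tup_env3:
  assumes "length x = m" "length y = m" "length z = m"
  shows "tup m (env3 m e x y z) b = (if b = 1 then x else if b = 2 then y else if b = 3 then z else tup m e b)"
  unfolding env3_def using assms by (subst tup_setb) auto

lemma tup_update: "b' \<noteq> b \<Longrightarrow> tup m (e(prod_encode (b, i) := a)) b' = tup m e b'"
  by (simp add: tup_def)

lemma params_update: "0 < b \<Longrightarrow> params (e(prod_encode (b, i) := a)) = params e"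
  by (simp add: params_def fun_eq_iff)

lemma params_env3: "params (env3 m e x y z) = params e"
  by (simp add: env3_def params_setb)

lemma holds_prodF:
  assumes "j < m" "length x = m" "length y = m" "length z = m"
  shows "holds M (prodF m \<psi> j) ((env3 m e x y z)(prod_encode (4, 0) := a)) \<longleftrightarrow>
    (\<exists>v. length v = m \<and> mulr M m \<psi> (params e) x y v \<and>
      (\<exists>w. length w = m \<and> mulr M m \<psi> (params e) v z w \<and> w ! j = a))"
proof -
  have "setb m {6} (\<lambda>_. w) e' (prod_encode (6, j)) = w ! j" for w :: "'a list" and e'
    using assms(1) by (simp add: setb_def)
  moreover have "setb m {6} (\<lambda>_. w) (setb m {5} (\<lambda>_. v) ((env3 m e x y z)(prod_encode (4, 0) := a))) (prod_encode (4, 0)) = a"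
    for v w :: "'a list"
    by (simp add: setb_def)
  ultimately show ?thesis using assms(2-4)
    by (simp add: prodF_def holds_exb1 holds_mulF tup_setb params_setb tup_update tup_env3 params_update params_env3
        cong: conj_cong)
qed

locale definable_integer_group =
  fixes m :: nat and \<phi> \<psi> :: pform and e :: "nat \<Rightarrow> int" and G :: "int list monoid" (structure)
  assumes group: "group G" and carrier: "carrier G = car Zstr m \<phi> (params e)"
    and mul: "\<And>x y z. length x = m \<Longrightarrow> length y = m \<Longrightarrow> length z = m \<Longrightarrow>
       mulr Zstr m \<psi> (params e) x y z \<longleftrightarrow> x \<in> carrier G \<and> y \<in> carrier G \<and> z = x \<otimes> y"
begin

lemma len: "x \<in> carrier G \<Longrightarrow> length x = m"
  by (simp add: carrier car_length)

lemma closed: "x \<in> carrier G \<Longrightarrow> y \<in> carrier G \<Longrightarrow> x \<otimes> y \<in> carrier G"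
  using group by (simp add: group_def monoid.m_closed)

lemma holds_product_coordinate:
  assumes "j < m" "x \<in> carrier G" "y \<in> carrier G" "z \<in> carrier G"
  shows "holds Zstr (prodF m \<psi> j) ((env3 m e x y z)(prod_encode (4, 0) := a)) \<longleftrightarrow> a = (x \<otimes> y \<otimes> z) ! j"
  unfolding holds_prodF[OF assms(1) len[OF assms(2)] len[OF assms(3)] len[OF assms(4)]]
  using assms len closed by (auto simp: mul cong: conj_cong)

end

text \<open>Each coordinate of \<open>x y z\<close> is, up to a positive factor, one of finitely many linear
  terms, and the choice depends only on the \<open>equi\<close>-class of \<open>(x, y, z)\<close>.\<close>

definition linear_coordinate ::
  "nat \<Rightarrow> pform \<Rightarrow> nat \<Rightarrow> ((nat \<Rightarrow> int) \<Rightarrow> int) set \<Rightarrow> int \<Rightarrow> int \<Rightarrow> ((nat \<Rightarrow> int) \<Rightarrow> int) set \<Rightarrow> bool" where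
  "linear_coordinate m \<psi> j L N k B \<longleftrightarrow>
    finite L \<and> L \<subseteq> lin \<and> 0 < N \<and> 0 < k \<and> finite B \<and> B \<subseteq> lin \<and>
    (\<forall>\<phi> e (G :: int list monoid). definable_integer_group m \<phi> \<psi> e G \<longrightarrow>
      (\<forall>x\<in>carrier G. \<forall>y\<in>carrier G. \<forall>z\<in>carrier G. \<exists>\<beta>\<in>B.
        \<forall>x'\<in>carrier G. \<forall>y'\<in>carrier G. \<forall>z'\<in>carrier G.
          equi L N (env3 m e x y z) (env3 m e x' y' z') \<longrightarrow>
          k * (x' \<otimes>\<^bsub>G\<^esub> y' \<otimes>\<^bsub>G\<^esub> z') ! j = \<beta> (env3 m e x' y' z')))"

text \<open>The coordinate is the only value satisfying \<open>prodF\<close>, hence alone in its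
  class, and the uniqueness clause of \<open>elimination_step\<close> supplies the affine
  term.\<close>

lemma product_coordinate_linear:
  assumes "j < m"
  shows "\<exists>L N k B. linear_coordinate m \<psi> j L N k B"
proof -
  let ?v = "prod_encode (4, 0)"
  obtain L N where L: "finite L" "L \<subseteq> lin" "0 < N"
    and inv: "\<And>e e'. equi L N e e' \<Longrightarrow> holds Zstr (prodF m \<psi> j) e = holds Zstr (prodF m \<psi> j) e'"
    using simple_holds[of "prodF m \<psi> j"] unfolding simple_def by blast
  show ?thesis unfolding linear_coordinate_def
  proof (rule elimination_step[OF L, of ?v], intro exI conjI allI impI ballI)
    fix L' N' and k :: int and B and \<phi> e and G :: "int list monoid" and x y z
    assume step: "\<And>e a. (\<And>a'. equi L N (e(?v := a)) (e(?v := a')) \<Longrightarrow> a' = a) \<Longrightarrow>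
       \<exists>\<beta>\<in>B. \<forall>e'. equi L' N' e e' \<longrightarrow> (\<exists>a'. k * a' = \<beta> e' \<and> equi L N (e(?v := a)) (e'(?v := a')))"
      and dig: "definable_integer_group m \<phi> \<psi> e G"
      and xyz: "x \<in> carrier G" "y \<in> carrier G" "z \<in> carrier G"
    interpret definable_integer_group m \<phi> \<psi> e G by (rule dig)
    note hp = holds_product_coordinate[OF assms]
    define a where "a = (x \<otimes>\<^bsub>G\<^esub> y \<otimes>\<^bsub>G\<^esub> z) ! j"
    have holds: "holds Zstr (prodF m \<psi> j) ((env3 m e x y z)(?v := a))" using hp[OF xyz] by (simp add: a_def)
    have "a' = a" if "equi L N ((env3 m e x y z)(?v := a)) ((env3 m e x y z)(?v := a'))" for a'
      using inv[OF that] holds unfolding hp[OF xyz] by (simp add: a_def)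
    from step[OF this] obtain \<beta> where "\<beta> \<in> B" and \<beta>: "\<And>e'. equi L' N' (env3 m e x y z) e' \<Longrightarrow>
        \<exists>a'. k * a' = \<beta> e' \<and> equi L N ((env3 m e x y z)(?v := a)) (e'(?v := a'))" by blast
    show "\<exists>\<beta>\<in>B. \<forall>x'\<in>carrier G. \<forall>y'\<in>carrier G. \<forall>z'\<in>carrier G.
        equi L' N' (env3 m e x y z) (env3 m e x' y' z') \<longrightarrow>
        k * (x' \<otimes>\<^bsub>G\<^esub> y' \<otimes>\<^bsub>G\<^esub> z') ! j = \<beta> (env3 m e x' y' z')"
    proof (intro bexI ballI impI)
      fix x' y' z' assume xyz': "x' \<in> carrier G" "y' \<in> carrier G" "z' \<in> carrier G"
        and E: "equi L' N' (env3 m e x y z) (env3 m e x' y' z')"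
      from \<beta>[OF E] obtain a' where a': "k * a' = \<beta> (env3 m e x' y' z')"
        "equi L N ((env3 m e x y z)(?v := a)) ((env3 m e x' y' z')(?v := a'))" by blast
      have "a' = (x' \<otimes>\<^bsub>G\<^esub> y' \<otimes>\<^bsub>G\<^esub> z') ! j"
        using inv[OF a'(2)] holds unfolding hp[OF xyz'] by blast
      then show "k * (x' \<otimes>\<^bsub>G\<^esub> y' \<otimes>\<^bsub>G\<^esub> z') ! j = \<beta> (env3 m e x' y' z')" using a'(1) by simp
    qed (rule \<open>\<beta> \<in> B\<close>)
  qed
qed

text \<open>As in \<open>lin_separable\<close>, the slope \<open>C\<close> is fixed before
  \<open>e\<close> and only the additive constant may depend on it.\<close>

lemma finite_lin_bound:
  assumes "finite B" "B \<subseteq> lin"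
  shows "\<exists>C\<ge>0. \<forall>e. \<exists>c. \<forall>\<beta>\<in>B. \<forall>x y z. length x = m \<longrightarrow> length y = m \<longrightarrow> length z = m \<longrightarrow>
    \<bar>\<beta> (env3 m e x y z)\<bar> \<le> C * (norm1 x + norm1 y + norm1 z) + c"
  using assms
proof (induction B rule: finite_induct)
  case (insert l B)
  then obtain C where C: "0 \<le> C" "\<And>e. \<exists>c. \<forall>\<beta>\<in>B. \<forall>x y z. length x = m \<longrightarrow> length y = m \<longrightarrow> length z = m \<longrightarrow>
    \<bar>\<beta> (env3 m e x y z)\<bar> \<le> C * (norm1 x + norm1 y + norm1 z) + c" by auto
  have "l \<in> lin" using insert.prems by simp
  from lin_separable[OF this, of m] obtain D where D: "0 \<le> D" "\<And>e. \<exists>f g h c.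
    (\<forall>x. length x = m \<longrightarrow> \<bar>f x\<bar> \<le> D * norm1 x \<and> \<bar>g x\<bar> \<le> D * norm1 x \<and> \<bar>h x\<bar> \<le> D * norm1 x) \<and>
    (\<forall>x y z. l (env3 m e x y z) = f x + g y + h z + c)" by blast
  show ?case
  proof (rule exI[of _ "C + D"], intro conjI allI)
    fix e :: "nat \<Rightarrow> int"
    obtain c where c: "\<And>\<beta> x y z. \<beta> \<in> B \<Longrightarrow> length x = m \<Longrightarrow> length y = m \<Longrightarrow> length z = m \<Longrightarrow>
      \<bar>\<beta> (env3 m e x y z)\<bar> \<le> C * (norm1 x + norm1 y + norm1 z) + c" using C(2)[of e] by blast
    obtain f g h d where fgh: "\<And>x. length x = m \<Longrightarrow> \<bar>f x\<bar> \<le> D * norm1 x \<and> \<bar>g x\<bar> \<le> D * norm1 x \<and> \<bar>h x\<bar> \<le> D * norm1 x"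
      "\<And>x y z. l (env3 m e x y z) = f x + g y + h z + d" using D(2)[of e] by blast
    have "\<bar>\<beta> (env3 m e x y z)\<bar> \<le> (C + D) * (norm1 x + norm1 y + norm1 z) + (\<bar>c\<bar> + \<bar>d\<bar>)"
      if \<beta>: "\<beta> \<in> insert l B" and len: "length x = m" "length y = m" "length z = m" for \<beta> x y z
    proof -
      let ?n = "norm1 x + norm1 y + norm1 z"
      have n: "0 \<le> ?n" using norm1_nonneg[of x] norm1_nonneg[of y] norm1_nonneg[of z] by simp
      have CD: "C * ?n \<le> (C + D) * ?n" "D * ?n \<le> (C + D) * ?n"
        using C(1) D(1) n by (simp_all add: mult_right_mono)
      show ?thesis
      proof (cases "\<beta> = l")
        case True
        have "\<bar>l (env3 m e x y z)\<bar> \<le> D * ?n + \<bar>d\<bar>"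
        proof -
          have "\<bar>f x\<bar> \<le> D * norm1 x" "\<bar>g y\<bar> \<le> D * norm1 y" "\<bar>h z\<bar> \<le> D * norm1 z" using fgh(1) len by simp_all
          then show ?thesis by (simp add: fgh(2) distrib_left)
        qed
        then show ?thesis using CD True by simp
      next
        case False
        then have "\<bar>\<beta> (env3 m e x y z)\<bar> \<le> C * ?n + c" using c \<beta> len by simp
        then show ?thesis using CD by simp
      qed
    qed
    then show "\<exists>c. \<forall>\<beta>\<in>insert l B. \<forall>x y z. length x = m \<longrightarrow> length y = m \<longrightarrow> length z = m \<longrightarrow>
      \<bar>\<beta> (env3 m e x y z)\<bar> \<le> (C + D) * (norm1 x + norm1 y + norm1 z) + c" by blast
  qed (use C(1) D(1) in simp)
qed auto

lemma separating_integer_group: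
  "\<exists>C q. \<forall>\<phi> e (G :: int list monoid). definable_integer_group m \<phi> \<psi> e G \<longrightarrow>
    (\<exists>c. separating_group G (\<lambda>x. nat (norm1 x)) C c m q)"
proof -
  have "\<forall>j. \<exists>L N k B. j < m \<longrightarrow> linear_coordinate m \<psi> j L N k B"
    using product_coordinate_linear by blast
  then obtain L N k B where LNkB: "\<And>j. j < m \<Longrightarrow> linear_coordinate m \<psi> j (L j) (N j) (k j) (B j)"
    by metis
  have L: "finite (L j) \<and> L j \<subseteq> lin" and N: "0 < N j" and k: "0 < k j" and B: "finite (B j) \<and> B j \<subseteq> lin"
    if "j < m" for j
    using LNkB[OF that] unfolding linear_coordinate_def by simp_all
  have coord: "\<exists>\<beta>\<in>B j. \<forall>x'\<in>carrier G. \<forall>y'\<in>carrier G. \<forall>z'\<in>carrier G.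
      equi (L j) (N j) (env3 m e x y z) (env3 m e x' y' z') \<longrightarrow>
      k j * (x' \<otimes>\<^bsub>G\<^esub> y' \<otimes>\<^bsub>G\<^esub> z') ! j = \<beta> (env3 m e x' y' z')"
    if "j < m" "definable_integer_group m \<phi> \<psi> e G" "x \<in> carrier G" "y \<in> carrier G" "z \<in> carrier G"
    for j \<phi> e and G :: "int list monoid" and x y z
    using LNkB[OF that(1)] that(2-5) unfolding linear_coordinate_def by simp
  define LL where "LL = (\<Union>j<m. L j)"
  define NN where "NN = (\<Prod>j<m. N j)"
  have LL: "finite LL" "LL \<subseteq> lin" using L by (auto simp: LL_def)
  have NN: "0 < NN" unfolding NN_def using N by (intro prod_pos) auto
  have equi_coord: "equi (L j) (N j) v v'" if "equi LL NN v v'" "j < m" for v v' j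
    using that(1) by (rule equi_mono) (use that(2) in \<open>auto simp: LL_def NN_def intro: dvd_prodI\<close>)
  have "finite (\<Union>j<m. B j)" "(\<Union>j<m. B j) \<subseteq> lin" using B by auto
  from finite_lin_bound[OF this, of m] obtain C0 where C0: "0 \<le> C0"
    "\<And>e. \<exists>c. \<forall>\<beta>\<in>(\<Union>j<m. B j). \<forall>x y z. length x = m \<longrightarrow> length y = m \<longrightarrow> length z = m \<longrightarrow>
    \<bar>\<beta> (env3 m e x y z)\<bar> \<le> C0 * (norm1 x + norm1 y + norm1 z) + c" by blast
  \<comment> \<open>A sum over \<open>m\<close> coordinates, each of slope at most
    \<open>C0\<close>; the summand 1 ensures \<open>1 \<le> C\<close>.\<close>
  define C where "C = nat (int m * C0) + 1"
  \<comment> \<open>Fixing the residues of all coordinates costs the factor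
    \<open>nat NN ^ m\<close>, and fixing the signs of the functionals costs 2 for each of
    them.\<close>
  define q where "q = nat NN ^ m * 2 ^ card LL"
  have "\<exists>c. separating_group G (\<lambda>x. nat (norm1 x)) C c m q"
    if dig: "definable_integer_group m \<phi> \<psi> e G" for \<phi> e and G :: "int list monoid"
  proof -
    interpret definable_integer_group m \<phi> \<psi> e G by (rule dig)
    interpret group G by (rule group)
    obtain c0 where c0: "\<And>j \<beta> x y z. j < m \<Longrightarrow> \<beta> \<in> B j \<Longrightarrow> length x = m \<Longrightarrow> length y = m \<Longrightarrow> length z = m \<Longrightarrow>
      \<bar>\<beta> (env3 m e x y z)\<bar> \<le> C0 * (norm1 x + norm1 y + norm1 z) + c0" using C0(2)[of e] by blast
    have norm_prod: "norm1 (x \<otimes>\<^bsub>G\<^esub> y \<otimes>\<^bsub>G\<^esub> z) \<le> int m * (C0 * (norm1 x + norm1 y + norm1 z) + c0)"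
      if xyz: "x \<in> carrier G" "y \<in> carrier G" "z \<in> carrier G" for x y z
    proof -
      let ?w = "x \<otimes>\<^bsub>G\<^esub> y \<otimes>\<^bsub>G\<^esub> z" and ?t = "C0 * (norm1 x + norm1 y + norm1 z) + c0"
      have w: "length ?w = m" using xyz by (intro len) simp
      have "\<bar>?w ! j\<bar> \<le> ?t" if j: "j < m" for j
      proof -
        obtain \<beta> where \<beta>: "\<beta> \<in> B j" "k j * ?w ! j = \<beta> (env3 m e x y z)"
          using coord[OF j dig xyz] xyz equi_refl by blast
        have "1 * \<bar>?w ! j\<bar> \<le> \<bar>k j\<bar> * \<bar>?w ! j\<bar>" using k[OF j] by (intro mult_right_mono) auto
        also have "\<dots> = \<bar>\<beta> (env3 m e x y z)\<bar>" unfolding \<beta>(2)[symmetric] by (simp add: abs_mult)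
        also have "\<dots> \<le> ?t" using c0[OF j \<beta>(1)] len xyz by simp
        finally show ?thesis by simp
      qed
      then have "norm1 ?w \<le> (\<Sum>j<length ?w. ?t)" using w by (intro norm1_le) auto
      then show ?thesis using w by simp
    qed
    \<comment> \<open>A product of two elements is treated as a triple product with the unit as
      third factor, whose norm goes into \<open>c\<close>.\<close>
    define c where "c = nat (int m * \<bar>C0 * norm1 \<one>\<^bsub>G\<^esub> + c0\<bar>)"
    have "separating_group G (\<lambda>x. nat (norm1 x)) C c m q"
    proof unfold_locales
      show "1 \<le> C" by (simp add: C_def)
      show "1 \<le> q" using NN by (simp add: q_def)
      fix R
      have sub: "{x \<in> carrier G. nat (norm1 x) \<le> R} \<subseteq> {x. length x = m \<and> norm1 x \<le> int R}"
        using len by auto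
      show "finite {x \<in> carrier G. nat (norm1 x) \<le> R}" using sub ball_norm1(1) by (rule finite_subset)
      show "card {x \<in> carrier G. nat (norm1 x) \<le> R} \<le> (2 * R + 1) ^ m"
        using card_mono[OF ball_norm1(1) sub] ball_norm1(2) by (rule le_trans)
    next
      fix x y assume xy: "x \<in> carrier G" "y \<in> carrier G"
      let ?n = "norm1 x + norm1 y"
      have n: "0 \<le> norm1 x" "0 \<le> norm1 y" by (simp_all add: norm1_nonneg)
      have "norm1 (x \<otimes>\<^bsub>G\<^esub> y) \<le> int m * (C0 * (?n + norm1 \<one>\<^bsub>G\<^esub>) + c0)"
        using norm_prod[OF xy one_closed] xy by simp
      also have "\<dots> = (int m * C0) * ?n + int m * (C0 * norm1 \<one>\<^bsub>G\<^esub> + c0)" by (simp add: algebra_simps)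
      also have "\<dots> \<le> int C * ?n + int c"
      proof (rule add_mono)
        show "int m * C0 * ?n \<le> int C * ?n" using C0(1) n by (intro mult_right_mono) (auto simp: C_def)
        show "int m * (C0 * norm1 \<one>\<^bsub>G\<^esub> + c0) \<le> int c" by (simp add: c_def mult_left_mono)
      qed
      also have "\<dots> = int (C * (nat (norm1 x) + nat (norm1 y)) + c)" using n by simp
      finally show "nat (norm1 (x \<otimes>\<^bsub>G\<^esub> y)) \<le> C * (nat (norm1 x) + nat (norm1 y)) + c"
        unfolding nat_le_iff .
    next
      fix X Y Z assume fin: "finite X" "finite Y" "finite Z"
        and cX: "X \<subseteq> carrier G" and cY: "Y \<subseteq> carrier G" and cZ: "Z \<subseteq> carrier G"
      have lens: "x \<in> X \<Longrightarrow> length x = m" "x \<in> Y \<Longrightarrow> length x = m" "x \<in> Z \<Longrightarrow> length x = m" for x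
        using cX cY cZ len by auto
      obtain X1 where X1: "X1 \<subseteq> X" "card X \<le> nat NN ^ m * card X1"
        "\<And>x y i. x \<in> X1 \<Longrightarrow> y \<in> X1 \<Longrightarrow> i < m \<Longrightarrow> [x ! i = y ! i] (mod NN)"
        using same_residues[OF fin(1) lens(1) NN] by blast
      obtain Y1 where Y1: "Y1 \<subseteq> Y" "card Y \<le> nat NN ^ m * card Y1"
        "\<And>x y i. x \<in> Y1 \<Longrightarrow> y \<in> Y1 \<Longrightarrow> i < m \<Longrightarrow> [x ! i = y ! i] (mod NN)"
        using same_residues[OF fin(2) lens(2) NN] by blast
      obtain Z1 where Z1: "Z1 \<subseteq> Z" "card Z \<le> nat NN ^ m * card Z1"
        "\<And>x y i. x \<in> Z1 \<Longrightarrow> y \<in> Z1 \<Longrightarrow> i < m \<Longrightarrow> [x ! i = y ! i] (mod NN)"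
        using same_residues[OF fin(3) lens(3) NN] by blast
      have sep: "\<exists>f g h c. \<forall>x y z. l (env3 m e x y z) = f x + g y + h z + c" if "l \<in> lin" for l
        using lin_separable[OF that, of m] by blast
      then have "\<forall>l\<in>LL. \<exists>f g h c. \<forall>x y z. l (env3 m e x y z) = f x + g y + h z + c" using LL(2) by blast
      then obtain f g h d where fgh: "\<And>l x y z. l \<in> LL \<Longrightarrow> l (env3 m e x y z) = f l x + g l y + h l z + d l"
        by metis
      have fin1: "finite X1" "finite Y1" "finite Z1"
        by (rule finite_subset[OF X1(1) fin(1)], rule finite_subset[OF Y1(1) fin(2)], rule finite_subset[OF Z1(1) fin(3)])
      obtain X2 Y2 Z2 where 2: "X2 \<subseteq> X1" "Y2 \<subseteq> Y1" "Z2 \<subseteq> Z1"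
        "card X1 \<le> 2 ^ card LL * card X2" "card Y1 \<le> 2 ^ card LL * card Y2" "card Z1 \<le> 2 ^ card LL * card Z2"
        and signs: "\<forall>l\<in>LL. \<exists>s. \<forall>x\<in>X2. \<forall>y\<in>Y2. \<forall>z\<in>Z2. (0 \<le> f l x + g l y + h l z + d l) = s"
        using split_signs[OF LL(1) fin1, of f g h d] by (elim exE conjE) (rule that)
      have sub: "X2 \<subseteq> X" "Y2 \<subseteq> Y" "Z2 \<subseteq> Z" using X1(1) Y1(1) Z1(1) 2(1-3) by auto
      \<comment> \<open>The residues are constant on each of the three sets and the signs on their
        product, so the whole box is one class and a single affine term serves for it.\<close>
      have same: "equi LL NN (env3 m e x y z) (env3 m e x' y' z')"
        if "x \<in> X2" "x' \<in> X2" "y \<in> Y2" "y' \<in> Y2" "z \<in> Z2" "z' \<in> Z2" for x x' y y' z z'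
      proof -
        have "(0 \<le> l (env3 m e x y z)) = (0 \<le> l (env3 m e x' y' z'))" if l: "l \<in> LL" for l
        proof -
          from bspec[OF signs l] obtain s
            where s: "\<forall>x\<in>X2. \<forall>y\<in>Y2. \<forall>z\<in>Z2. (0 \<le> f l x + g l y + h l z + d l) = s" ..
          then have "(0 \<le> l (env3 m e u v w)) = s" if "u \<in> X2" "v \<in> Y2" "w \<in> Z2" for u v w
            using that unfolding fgh[OF l] by blast
          then show ?thesis using \<open>x \<in> X2\<close> \<open>x' \<in> X2\<close> \<open>y \<in> Y2\<close> \<open>y' \<in> Y2\<close> \<open>z \<in> Z2\<close> \<open>z' \<in> Z2\<close> by simp
        qed
        moreover have "[env3 m e x y z n = env3 m e x' y' z' n] (mod NN)" for n
        proof -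
          obtain b i where n: "n = prod_encode (b, i)" by (metis prod_decode_inverse surj_pair)
          have "x \<in> X1" "x' \<in> X1" "y \<in> Y1" "y' \<in> Y1" "z \<in> Z1" "z' \<in> Z1" using that 2(1-3) by auto
          then show ?thesis unfolding n env3_apply using X1(3) Y1(3) Z1(3) by simp
        qed
        ultimately show ?thesis by (simp add: equi_def)
      qed
      have match: "x \<otimes>\<^bsub>G\<^esub> y' \<otimes>\<^bsub>G\<^esub> z = x' \<otimes>\<^bsub>G\<^esub> y' \<otimes>\<^bsub>G\<^esub> z'"
        if in2: "x \<in> X2" "x' \<in> X2" "y \<in> Y2" "y' \<in> Y2" "z \<in> Z2" "z' \<in> Z2"
          and eq: "x \<otimes>\<^bsub>G\<^esub> y \<otimes>\<^bsub>G\<^esub> z = x' \<otimes>\<^bsub>G\<^esub> y \<otimes>\<^bsub>G\<^esub> z'" for x x' y y' z z'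
      proof (rule nth_equalityI)
        have cc: "x \<in> carrier G" "x' \<in> carrier G" "y \<in> carrier G" "y' \<in> carrier G" "z \<in> carrier G" "z' \<in> carrier G"
          using in2 sub cX cY cZ by auto
        have l: "length (x \<otimes>\<^bsub>G\<^esub> y' \<otimes>\<^bsub>G\<^esub> z) = m" "length (x' \<otimes>\<^bsub>G\<^esub> y' \<otimes>\<^bsub>G\<^esub> z') = m"
          using cc by (auto intro: len)
        then show "length (x \<otimes>\<^bsub>G\<^esub> y' \<otimes>\<^bsub>G\<^esub> z) = length (x' \<otimes>\<^bsub>G\<^esub> y' \<otimes>\<^bsub>G\<^esub> z')" by simp
        fix j assume "j < length (x \<otimes>\<^bsub>G\<^esub> y' \<otimes>\<^bsub>G\<^esub> z)"
        then have j: "j < m" using l by simp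
        obtain \<beta> where \<beta>: "\<beta> \<in> B j" and \<beta>_eq: "\<forall>u\<in>carrier G. \<forall>v\<in>carrier G. \<forall>w\<in>carrier G.
          equi (L j) (N j) (env3 m e x y z) (env3 m e u v w) \<longrightarrow>
          k j * (u \<otimes>\<^bsub>G\<^esub> v \<otimes>\<^bsub>G\<^esub> w) ! j = \<beta> (env3 m e u v w)"
          using coord[OF j dig cc(1,3,5)] by blast
        have lin: "k j * (u \<otimes>\<^bsub>G\<^esub> v \<otimes>\<^bsub>G\<^esub> w) ! j = \<beta> (env3 m e u v w)"
          if "u \<in> X2" "v \<in> Y2" "w \<in> Z2" for u v w
        proof -
          have "equi (L j) (N j) (env3 m e x y z) (env3 m e u v w)"
            by (rule equi_coord[OF same j]) (use that in2 in simp_all)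
          moreover have "u \<in> carrier G" "v \<in> carrier G" "w \<in> carrier G" using that sub cX cY cZ by auto
          ultimately show ?thesis using \<beta>_eq by simp
        qed
        have "\<beta> \<in> lin" using \<beta> B[OF j] by blast
        from sep[OF this] obtain f g h d where "\<forall>x y z. \<beta> (env3 m e x y z) = f x + g y + h z + d" by blast
        then have val: "k j * (u \<otimes>\<^bsub>G\<^esub> v \<otimes>\<^bsub>G\<^esub> w) ! j = f u + g v + h w + d"
          if "u \<in> X2" "v \<in> Y2" "w \<in> Z2" for u v w
          using lin[OF that] by simp
        \<comment> \<open>The contribution \<open>g y\<close> of the common middle factor cancels,
          and that of \<open>y'\<close> may be put in its place.\<close>
        have "f x + h z = f x' + h z'"
          using val[OF in2(1,3,5)] val[OF in2(2,3,6)] eq by simp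
        then have "k j * (x \<otimes>\<^bsub>G\<^esub> y' \<otimes>\<^bsub>G\<^esub> z) ! j = k j * (x' \<otimes>\<^bsub>G\<^esub> y' \<otimes>\<^bsub>G\<^esub> z') ! j"
          using val[OF in2(1,4,5)] val[OF in2(2,4,6)] by simp
        then show "(x \<otimes>\<^bsub>G\<^esub> y' \<otimes>\<^bsub>G\<^esub> z) ! j = (x' \<otimes>\<^bsub>G\<^esub> y' \<otimes>\<^bsub>G\<^esub> z') ! j"
          using k[OF j] by simp
      qed
      have scale: "a \<le> q * b" if "a \<le> nat NN ^ m * i" "i \<le> 2 ^ card LL * b" for a b i
        using le_trans[OF that(1) mult_le_mono2[OF that(2)]] by (simp add: q_def mult.assoc)
      show "\<exists>X'\<subseteq>X. \<exists>Y'\<subseteq>Y. \<exists>Z'\<subseteq>Z. card X \<le> q * card X' \<and> card Y \<le> q * card Y' \<and> card Z \<le> q * card Z' \<and>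
        (\<forall>h\<in>X'. \<forall>h'\<in>X'. \<forall>z\<in>Y'. \<forall>z'\<in>Y'. \<forall>g\<in>Z'. \<forall>g'\<in>Z'.
           h \<otimes>\<^bsub>G\<^esub> z \<otimes>\<^bsub>G\<^esub> g = h' \<otimes>\<^bsub>G\<^esub> z \<otimes>\<^bsub>G\<^esub> g' \<longrightarrow> h \<otimes>\<^bsub>G\<^esub> z' \<otimes>\<^bsub>G\<^esub> g = h' \<otimes>\<^bsub>G\<^esub> z' \<otimes>\<^bsub>G\<^esub> g')"
        by (intro exI[of _ X2] exI[of _ Y2] exI[of _ Z2] conjI ballI impI sub
            scale[OF X1(2) 2(4)] scale[OF Y1(2) 2(5)] scale[OF Z1(2) 2(6)]) (rule match, assumption+)
    qed
    then show ?thesis by blast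
  qed
  then show ?thesis by blast
qed

section \<open>Transfer\<close>

context separating_group
begin

text \<open>A formula quantifies over a fixed number of tuples, so the finite set is listed with
  repetitions as exactly \<open>q * K\<close> elements; copies of the unit stand for the empty set,
  having the same centralizer.\<close>

lemma bicentral_family:
  "\<exists>E :: nat \<Rightarrow> 'a. (\<forall>k. E k \<in> carrier G) \<and>
    (\<forall>S. separated (centr (E ` {..<q * K}) \<inter> centr (centr (E ` {..<q * K}))) S \<longrightarrow>
      card S \<le> (q * K) * (q * (q * K) * K))"
proof -
  obtain F where F: "F \<subseteq> carrier G" "finite F" "card F \<le> q * K"
    and b1: "\<And>S. separated (centr F) S \<Longrightarrow> card S \<le> q * K"
    and b2: "\<And>S. separated (centr (centr F)) S \<Longrightarrow> card S \<le> q * (q * K) * K"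
    using centralizer_finite_index by blast
  have "0 < q * K" using q C by simp
  have "\<exists>E. (\<forall>k. E k \<in> carrier G) \<and> centr (E ` {..<q * K}) = centr F"
  proof (cases "F = {}")
    case True
    have "centr ((\<lambda>_. \<one>) ` {..<q * K}) = centr F" by (auto simp: True centr_def)
    then show ?thesis by (intro exI[of _ "\<lambda>_. \<one>"]) simp
  next
    case False
    obtain h where h: "bij_betw h {0..<card F} F" using ex_bij_betw_nat_finite[OF F(2)] by blast
    have pos: "0 < card F" using False F(2) by (simp add: card_gt_0_iff)
    define E where "E k = h (if k < card F then k else 0)" for k
    have hF: "h k \<in> F" if "k < card F" for k using h that by (auto simp: bij_betw_def)
    then have EF: "E k \<in> F" for k using pos by (simp add: E_def)
    have "x \<in> E ` {..<q * K}" if "x \<in> F" for x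
    proof -
      have "x \<in> h ` {0..<card F}" using that bij_betw_imp_surj_on[OF h] by simp
      then obtain k where k: "k < card F" "x = h k" by auto
      then have "x = E k" "k < q * K" using F(3) by (simp_all add: E_def)
      then show ?thesis by blast
    qed
    then have "E ` {..<q * K} = F" using EF by blast
    then show ?thesis using EF F(1) by (intro exI[of _ E]) auto
  qed
  then obtain E where E: "\<forall>k. E k \<in> carrier G" "centr (E ` {..<q * K}) = centr F"
    by (elim exE conjE) (rule that)
  show ?thesis
  proof (intro exI[of _ E] conjI E(1) allI impI)
    fix S assume S: "separated (centr (E ` {..<q * K}) \<inter> centr (centr (E ` {..<q * K}))) S"
    show "card S \<le> (q * K) * (q * (q * K) * K)"
      by (rule separated_Int_bound[OF subgroup_centr[OF F(1)] b1 b2 S[unfolded E(2)]])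
  qed
qed

end

section \<open>Group-theoretic meaning of the first-order conditions\<close>

lemma commutes_in_iff:
  fixes G :: "('a list, 'b) monoid_scheme" (structure)
  assumes "group G"
    and mu: "\<And>x y z. x \<in> carrier G \<Longrightarrow> y \<in> carrier G \<Longrightarrow> z \<in> carrier G \<Longrightarrow> mu x y z \<longleftrightarrow> z = x \<otimes> y"
    and "x \<in> carrier G" "y \<in> carrier G"
  shows "commutes_in (carrier G) mu x y \<longleftrightarrow> x \<otimes> y = y \<otimes> x"
proof -
  interpret group G by fact
  show ?thesis using assms(3,4) by (auto simp: commutes_in_def mu)
qed

lemma bicentral_iff:
  fixes G :: "('a list, 'b) monoid_scheme" (structure)
  assumes G: "group G"
    and mu: "\<And>x y z. x \<in> carrier G \<Longrightarrow> y \<in> carrier G \<Longrightarrow> z \<in> carrier G \<Longrightarrow> mu x y z \<longleftrightarrow> z = x \<otimes> y"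
    and E: "\<And>k. k < r \<Longrightarrow> E k \<in> carrier G" and u: "u \<in> carrier G"
  shows "bicentral (carrier G) mu r E u \<longleftrightarrow>
    u \<in> group.centr G (E ` {..<r}) \<inter> group.centr G (group.centr G (E ` {..<r}))"
proof -
  interpret group G by fact
  have comm: "commutes_in (carrier G) mu x y \<longleftrightarrow> x \<otimes> y = y \<otimes> x" if "x \<in> carrier G" "y \<in> carrier G" for x y
    using commutes_in_iff[OF G mu that] .
  have "(\<forall>k<r. commutes_in (carrier G) mu v (E k)) \<longleftrightarrow> v \<in> centr (E ` {..<r})" if "v \<in> carrier G" for v
    using that E comm by (auto simp: centr_def)
  moreover have "v \<in> carrier G" if "v \<in> centr (E ` {..<r})" for v using that by (simp add: centr_def)
  ultimately show ?thesis using u comm unfolding bicentral_def centr_def[of "centr _"] by blast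
qed

lemma bounded_index_iff:
  fixes G :: "('a list, 'b) monoid_scheme" (structure)
  assumes G: "group G"
    and mu: "\<And>x y z. x \<in> carrier G \<Longrightarrow> y \<in> carrier G \<Longrightarrow> z \<in> carrier G \<Longrightarrow> mu x y z \<longleftrightarrow> z = x \<otimes> y"
    and E: "\<And>k. k < r \<Longrightarrow> E k \<in> carrier G"
  shows "bounded_index (carrier G) mu r N E \<longleftrightarrow>
    (\<forall>S. group.separated G (group.centr G (E ` {..<r}) \<inter> group.centr G (group.centr G (E ` {..<r}))) S \<longrightarrow> card S \<le> N)"
proof -
  interpret group G by fact
  let ?F = "E ` {..<r}"
  let ?Z = "centr ?F \<inter> centr (centr ?F)"
  have F: "?F \<subseteq> carrier G" using E by auto
  have Z: "subgroup ?Z G"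
    using F by (intro subgroups_Inter_pair subgroup_centr) (auto simp: centr_def)
  have bi: "bicentral (carrier G) mu r E u \<longleftrightarrow> u \<in> ?Z" if "u \<in> carrier G" for u
    using bicentral_iff[OF G mu E that] .
  have rel: "(\<exists>u\<in>carrier G. mu x u y \<and> bicentral (carrier G) mu r E u) \<longleftrightarrow> inv x \<otimes> y \<in> ?Z"
    if xy: "x \<in> carrier G" "y \<in> carrier G" for x y
  proof
    assume "\<exists>u\<in>carrier G. mu x u y \<and> bicentral (carrier G) mu r E u"
    then obtain u where u: "u \<in> carrier G" "y = x \<otimes> u" "u \<in> ?Z" using mu bi xy by blast
    then show "inv x \<otimes> y \<in> ?Z" using xy by (simp add: m_assoc[symmetric])
  next
    assume "inv x \<otimes> y \<in> ?Z"
    moreover have "y = x \<otimes> (inv x \<otimes> y)" using xy by (simp add: m_assoc[symmetric])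
    moreover have "inv x \<otimes> y \<in> carrier G" using xy by simp
    ultimately show "\<exists>u\<in>carrier G. mu x u y \<and> bicentral (carrier G) mu r E u"
      using mu bi xy by blast
  qed
  have "bounded_index (carrier G) mu r N E \<longleftrightarrow>
    (\<forall>g. (\<forall>i\<le>N. g i \<in> carrier G) \<longrightarrow> (\<exists>j\<le>N. \<exists>i<j. inv (g i) \<otimes> g j \<in> ?Z))"
    (is "?L \<longleftrightarrow> ?M")
  proof -
    define P Q where "P g \<longleftrightarrow> (\<exists>j\<le>N. \<exists>i<j. \<exists>u\<in>carrier G. mu (g i) u (g j) \<and> bicentral (carrier G) mu r E u)"
      and "Q g \<longleftrightarrow> (\<exists>j\<le>N. \<exists>i<j. inv (g i) \<otimes> g j \<in> ?Z)" for g
    have PQ: "P g \<longleftrightarrow> Q g" if g: "\<forall>i\<le>N. g i \<in> carrier G" for g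
    proof -
      have "(\<exists>u\<in>carrier G. mu (g i) u (g j) \<and> bicentral (carrier G) mu r E u) \<longleftrightarrow> inv (g i) \<otimes> g j \<in> ?Z"
        if "j \<le> N" "i < j" for i j
        by (rule rel) (use g that in simp_all)
      then show ?thesis unfolding P_def Q_def by meson
    qed
    have "?L \<longleftrightarrow> (\<forall>k<r. E k \<in> carrier G) \<and> (\<forall>g. (\<forall>i\<le>N. g i \<in> carrier G) \<longrightarrow> P g)"
      unfolding bounded_index_def P_def ..
    then show ?thesis using E PQ unfolding Q_def[symmetric] by blast
  qed
  also have "\<dots> \<longleftrightarrow> (\<forall>S. separated ?Z S \<longrightarrow> card S \<le> N)"
  proof
    assume M: ?M
    show "\<forall>S. separated ?Z S \<longrightarrow> card S \<le> N"
    proof (intro allI impI, rule ccontr)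
      fix S assume S: "separated ?Z S" and "\<not> card S \<le> N"
      then have card: "N < card S" and fin: "finite S" by (simp_all add: separated_def)
      obtain g where g: "bij_betw g {0..<card S} S" using ex_bij_betw_nat_finite[OF fin] by blast
      have gS: "g i \<in> S" if "i \<le> N" for i using bij_betwE[OF g] that card by auto
      then have "\<forall>i\<le>N. g i \<in> carrier G" using S by (auto simp: separated_def)
      with M obtain i j where ij: "j \<le> N" "i < j" "inv (g i) \<otimes> g j \<in> ?Z" by blast
      have "g i \<noteq> g j" using inj_onD[OF bij_betw_imp_inj_on[OF g], of i j] ij card by auto
      then show False using S gS[of i] gS[of j] ij by (auto simp: separated_def)
    qed
  next
    assume R: "\<forall>S. separated ?Z S \<longrightarrow> card S \<le> N"
    show ?M
    proof (intro allI impI, rule ccontr)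
      fix g assume g: "\<forall>i\<le>N. g i \<in> carrier G" and "\<not> (\<exists>j\<le>N. \<exists>i<j. inv (g i) \<otimes> g j \<in> ?Z)"
      then have no: "inv (g i) \<otimes> g j \<notin> ?Z" if "j \<le> N" "i < j" for i j using that by blast
      have no2: "inv (g i) \<otimes> g j \<notin> ?Z" if ij: "i \<le> N" "j \<le> N" "i \<noteq> j" for i j
      proof (cases "i < j")
        case False
        then have "inv (g j) \<otimes> g i \<notin> ?Z" using no ij by simp
        then show ?thesis using left_rel_sym[OF Z, of "g i" "g j"] g ij by blast
      qed (use no ij in simp)
      \<comment> \<open>A repetition in the sequence would give the quotient \<open>\<one>\<close>,
        which lies in the subgroup; so the entries form a separated set of \<open>N + 1\<close>
        elements.\<close>
      have inj: "inj_on g {..N}"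
      proof (rule inj_onI, rule ccontr)
        fix i j assume ij: "i \<in> {..N}" "j \<in> {..N}" "g i = g j" "i \<noteq> j"
        then have "inv (g i) \<otimes> g j = \<one>" using g by simp
        then show False using no2[of i j] ij subgroup.one_closed[OF Z] by simp
      qed
      have "separated ?Z (g ` {..N})" unfolding separated_def using g no2 by fastforce
      then have "card (g ` {..N}) \<le> N" using R by blast
      then show False by (simp add: card_image[OF inj])
    qed
  qed
  finally show ?thesis .
qed

lemma bounded_index_agree:
  assumes "\<And>k. k < r \<Longrightarrow> E k = E' k"
  shows "bounded_index A mu r N E = bounded_index A mu r N E'"
proof -
  have "bicentral A mu r E u = bicentral A mu r E' u" for u
    unfolding bicentral_def using assms by simp
  then show ?thesis unfolding bounded_index_def using assms by simp
qed

text \<open>This is the formula to be transferred. The parameters of \<open>\<phi>\<close> and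
  \<open>\<psi>\<close> remain free in block 0, so its validity under all assignments is uniformity
  in the parameters.\<close>

definition boundedF :: "nat \<Rightarrow> pform \<Rightarrow> pform \<Rightarrow> nat \<Rightarrow> nat \<Rightarrow> pform" where
  "boundedF m \<phi> \<psi> r N = imp (groupF m \<phi> \<psi>) (exb m (map (\<lambda>k. 10 + k) [0..<r]) (indexF m \<phi> \<psi> r N))"

lemma uniform_bound_integers: "\<exists>r N. \<forall>e. holds Zstr (boundedF m \<phi> \<psi> r N) e"
proof -
  obtain C q where Cq: "\<And>\<phi> e (G :: int list monoid). definable_integer_group m \<phi> \<psi> e G \<Longrightarrow>
    \<exists>c. separating_group G (\<lambda>x. nat (norm1 x)) C c m q" using separating_integer_group by blast
  \<comment> \<open>The constants of \<open>bicentral_family\<close> with \<open>K\<close> written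
    out, since they must be fixed before any group is given.\<close>
  define r where "r = q * (2 * (5 * C\<^sup>2) ^ m)"
  define N where "N = r * (q * r * (2 * (5 * C\<^sup>2) ^ m))"
  have "holds Zstr (boundedF m \<phi> \<psi> r N) e" for e
  proof -
    let ?A = "car Zstr m \<phi> (params e)" and ?mu = "mulr Zstr m \<psi> (params e)"
    have "holds Zstr (exb m (map (\<lambda>k. 10 + k) [0..<r]) (indexF m \<phi> \<psi> r N)) e"
      if ax: "group_axioms_on m ?A ?mu"
    proof -
      have cl: "length x = m" if "x \<in> ?A" for x using that by (rule car_length)
      obtain G :: "int list monoid" where G: "group G" "carrier G = ?A" and
        mul: "\<And>x y z. length x = m \<Longrightarrow> length y = m \<Longrightarrow> length z = m \<Longrightarrow>
          ?mu x y z \<longleftrightarrow> x \<in> ?A \<and> y \<in> ?A \<and> z = x \<otimes>\<^bsub>G\<^esub> y"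
        by (rule group_of_axioms[OF ax cl], assumption) (erule that, assumption, simp)
      have "definable_integer_group m \<phi> \<psi> e G"
        by (simp add: definable_integer_group_def G mul)
      from Cq[OF this] obtain c where "separating_group G (\<lambda>x. nat (norm1 x)) C c m q" by blast
      then interpret separating_group G "\<lambda>x. nat (norm1 x)" C c m q .
      have mu: "?mu x y z \<longleftrightarrow> z = x \<otimes>\<^bsub>G\<^esub> y" if "x \<in> carrier G" "y \<in> carrier G" "z \<in> carrier G" for x y z
        using mul[of x y z] that car_length unfolding G(2) by blast
      obtain E where E: "\<forall>k. E k \<in> carrier G" and
        bd: "\<forall>S. separated (centr (E ` {..<r}) \<inter> centr (centr (E ` {..<r}))) S \<longrightarrow> card S \<le> N"
        using bicentral_family[folded r_def, folded N_def] by (elim exE conjE) (rule that)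
      have "bounded_index (carrier G) ?mu r N E"
        by (rule iffD2[OF bounded_index_iff[OF G(1)]], rule mu, assumption+, rule E[rule_format], rule bd)
      then have bi: "bounded_index ?A ?mu r N E" unfolding G(2) .
      define X where "X b = E (b - 10)" for b
      let ?B = "set (map (\<lambda>k. 10 + k) [0..<r])"
      have X: "\<forall>b. length (X b) = m" using cl E unfolding X_def G(2) by simp
      have "tup m (setb m ?B X e) (10 + k) = E k" if "k < r" for k
        using X that by (subst tup_setb) (auto simp: X_def)
      then have "bounded_index ?A ?mu r N (\<lambda>k. tup m (setb m ?B X e) (10 + k))"
        using bi bounded_index_agree[of r "\<lambda>k. tup m (setb m ?B X e) (10 + k)" E] by simp
      moreover have "params (setb m ?B X e) = params e" by (rule params_setb) auto
      ultimately have "holds Zstr (indexF m \<phi> \<psi> r N) (setb m ?B X e)" by (simp add: holds_indexF)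
      then show ?thesis unfolding holds_exb using X by blast
    qed
    then show ?thesis by (simp add: boundedF_def holds_groupF)
  qed
  then show ?thesis by blast
qed

section \<open>Back to an arbitrary model\<close>

lemma group_axioms_on_group:
  fixes G :: "('a list, 'b) monoid_scheme" (structure)
  assumes "group G"
    and mul: "\<And>x y z. length x = m \<Longrightarrow> length y = m \<Longrightarrow> length z = m \<Longrightarrow>
      mu x y z \<longleftrightarrow> x \<in> carrier G \<and> y \<in> carrier G \<and> z = x \<otimes> y"
    and len: "\<And>x. x \<in> carrier G \<Longrightarrow> length x = m"
  shows "group_axioms_on m (carrier G) mu"
proof -
  interpret group G by fact
  have mu: "mu x y z \<longleftrightarrow> z = x \<otimes> y" if "x \<in> carrier G" "y \<in> carrier G" "z \<in> carrier G" for x y z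
    using mul[of x y z] that len by simp
  show ?thesis unfolding group_axioms_on_def
  proof (intro conjI)
    show "\<forall>x y z. length x = m \<longrightarrow> length y = m \<longrightarrow> length z = m \<longrightarrow> mu x y z \<longrightarrow>
      x \<in> carrier G \<and> y \<in> carrier G \<and> z \<in> carrier G" by (auto simp: mul)
    show "\<exists>o1\<in>carrier G. (\<forall>x\<in>carrier G. \<forall>y\<in>carrier G. mu o1 x y \<longrightarrow> y = x) \<and>
      (\<forall>x\<in>carrier G. \<exists>y\<in>carrier G. mu y x o1)"
    proof (rule bexI[of _ \<one>], intro conjI ballI impI)
      fix x assume "x \<in> carrier G"
      then show "\<exists>y\<in>carrier G. mu y x \<one>" by (intro bexI[of _ "inv x"]) (simp_all add: mu)
    qed (simp_all add: mu)
  qed (auto simp: mu m_assoc)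
qed

text \<open>\<open>definable\<close> wants the coordinates at the variables below \<open>m\<close>.
  The renaming moves block 1 there and every other variable \<open>n\<close> to
  \<open>m + n\<close>, which explains the parameter assignment \<open>e (i - m)\<close>.\<close>

lemma definable_setb:
  "definable M m {xs. length xs = m \<and> holds M \<chi> (setb m {1} (\<lambda>_. xs) e)}"
proof -
  define s where "s n = (case prod_decode n of (b, i) \<Rightarrow> if b = 1 \<and> i < m then i else m + n)" for n
  have "inj s"
  proof (rule injI)
    fix n n' assume eq: "s n = s n'"
    obtain b i b' i' where n: "n = prod_encode (b, i)" "n' = prod_encode (b', i')"
      by (metis prod_decode_inverse surj_pair)
    show "n = n'" using eq by (auto simp: s_def n split: if_splits)
  qed
  have "holds M (ren s \<chi>) (\<lambda>i. if i < m then xs ! i else e (i - m)) = holds M \<chi> (setb m {1} (\<lambda>_. xs) e)" for xs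
  proof -
    have "(\<lambda>n. if s n < m then xs ! s n else e (s n - m)) = setb m {1} (\<lambda>_. xs) e"
      by (auto simp: s_def setb_def fun_eq_iff split: prod.splits)
    then show ?thesis by (simp add: holds_ren[OF \<open>inj s\<close>])
  qed
  then show ?thesis unfolding definable_def
    by (intro exI[of _ "ren s \<chi>"] exI[of _ "\<lambda>i. e (i - m)"]) simp
qed

theorem theorem3p12:
  fixes M :: "'a pstruct" and m :: nat and G :: "('a list, 'b) monoid_scheme"
  assumes "presburger_model M"
      and "definable_group M m G"
  shows "\<exists>H. definable M m H \<and> subgroup H G \<and>
             (\<forall>x\<in>H. \<forall>y\<in>H. x \<otimes>\<^bsub>G\<^esub> y = y \<otimes>\<^bsub>G\<^esub> x) \<and>
             finite (rcosets\<^bsub>G\<^esub> H)"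
proof -
  have G: "group G" and len: "\<And>x. x \<in> carrier G \<Longrightarrow> length x = m"
    using assms(2) by (auto simp: definable_group_def)
  interpret group G by (rule G)
  obtain \<phi> p where \<phi>: "carrier G = {xs. length xs = m \<and> holds M \<phi> (\<lambda>i. if i < m then xs ! i else p i)}"
    using assms(2) unfolding definable_group_def definable_def by blast
  obtain \<psi> p' where \<psi>: "{xs @ ys @ zs | xs ys zs. xs \<in> carrier G \<and> ys \<in> carrier G \<and> zs = xs \<otimes>\<^bsub>G\<^esub> ys} =
    {ws. length ws = 3 * m \<and> holds M \<psi> (\<lambda>i. if i < 3 * m then ws ! i else p' i)}"
    using assms(2) unfolding definable_group_def definable_def by blast
  \<comment> \<open>Interleaves the two parameter assignments, \<open>p\<close> at even and
    \<open>p'\<close> at odd places.\<close>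
  define e where "e n = (let i = snd (prod_decode n) in if even i then p (i div 2) else p' (i div 2))" for n
  have par: "params e (2 * i) = p i" "params e (2 * i + 1) = p' i" for i
    by (simp_all add: params_def e_def)
  let ?mu = "mulr M m \<psi> (params e)"
  have A: "car M m \<phi> (params e) = carrier G" unfolding car_def par \<phi> ..
  have mul: "?mu x y z \<longleftrightarrow> x \<in> carrier G \<and> y \<in> carrier G \<and> z = x \<otimes>\<^bsub>G\<^esub> y"
    if l: "length x = m" "length y = m" "length z = m" for x y z
  proof -
    have "?mu x y z \<longleftrightarrow> x @ y @ z \<in> {ws. length ws = 3 * m \<and> holds M \<psi> (\<lambda>i. if i < 3 * m then ws ! i else p' i)}"
      unfolding mulr_def par using l by simp
    also have "\<dots> \<longleftrightarrow> (\<exists>xs ys zs. x @ y @ z = xs @ ys @ zs \<and> xs \<in> carrier G \<and> ys \<in> carrier G \<and> zs = xs \<otimes>\<^bsub>G\<^esub> ys)"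
      unfolding \<psi>[symmetric] by simp
    also have "\<dots> \<longleftrightarrow> x \<in> carrier G \<and> y \<in> carrier G \<and> z = x \<otimes>\<^bsub>G\<^esub> y"
    proof -
      have "x @ y @ z = xs @ ys @ zs \<longleftrightarrow> x = xs \<and> y = ys \<and> z = zs"
        if "xs \<in> carrier G" "ys \<in> carrier G" for xs ys zs
        using l len[OF that(1)] len[OF that(2)] by simp
      then show ?thesis by metis
    qed
    finally show ?thesis .
  qed
  have mu: "?mu x y z \<longleftrightarrow> z = x \<otimes>\<^bsub>G\<^esub> y" if "x \<in> carrier G" "y \<in> carrier G" "z \<in> carrier G" for x y z
    using mul[of x y z] that len by simp
  obtain r N where "\<And>e. holds Zstr (boundedF m \<phi> \<psi> r N) e" using uniform_bound_integers by blast
  then have "holds M (boundedF m \<phi> \<psi> r N) e" by (rule presburger_transfer[OF assms(1)])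
  moreover have "group_axioms_on m (carrier G) ?mu" using G mul len by (rule group_axioms_on_group)
  ultimately have "holds M (exb m (map (\<lambda>k. 10 + k) [0..<r]) (indexF m \<phi> \<psi> r N)) e"
    by (simp add: boundedF_def holds_groupF A)
  then obtain X where X: "\<forall>b. length (X b) = m"
    and idx: "holds M (indexF m \<phi> \<psi> r N) (setb m (set (map (\<lambda>k. 10 + k) [0..<r])) X e)"
    unfolding holds_exb by blast
  \<comment> \<open>The assignment extended by the transferred witnesses: these tuples are the
    additional parameters that define \<open>H\<close>.\<close>
  define e1 where "e1 = setb m (set (map (\<lambda>k. 10 + k) [0..<r])) X e"
  have par1: "params e1 = params e" unfolding e1_def by (rule params_setb) auto
  define E where "E k = tup m e1 (10 + k)" for k
  have bi: "bounded_index (carrier G) ?mu r N E"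
    using idx unfolding e1_def[symmetric] holds_indexF par1 A E_def .
  then have E: "E k \<in> carrier G" if "k < r" for k using that by (simp add: bounded_index_def)
  define H where "H = centr (E ` {..<r}) \<inter> centr (centr (E ` {..<r}))"
  have F: "E ` {..<r} \<subseteq> carrier G" using E by auto
  have H: "subgroup H G"
    unfolding H_def using F by (intro subgroups_Inter_pair subgroup_centr) (auto simp: centr_def)
  have bic: "bicentral (carrier G) ?mu r E u \<longleftrightarrow> u \<in> H" if "u \<in> carrier G" for u
    unfolding H_def by (rule bicentral_iff[OF G]) (use mu E that in simp_all)
  have "definable M m H"
  proof -
    have "holds M (Conj (carF m \<phi> 1) (bicentralF m \<phi> \<psi> r)) (setb m {1} (\<lambda>_. xs) e1) \<longleftrightarrow> xs \<in> H"
      if "length xs = m" for xs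
    proof -
      have "(\<lambda>k. tup m (setb m {1} (\<lambda>_. xs) e1) (10 + k)) = E"
        using that by (simp add: tup_setb E_def fun_eq_iff)
      then have "holds M (Conj (carF m \<phi> 1) (bicentralF m \<phi> \<psi> r)) (setb m {1} (\<lambda>_. xs) e1) \<longleftrightarrow>
        xs \<in> carrier G \<and> bicentral (carrier G) ?mu r E xs"
        using that by (simp add: holds_carF holds_bicentralF tup_setb params_setb par1 A)
      also have "\<dots> \<longleftrightarrow> xs \<in> H"
        using bic subgroup.mem_carrier[OF H] by blast
      finally show ?thesis .
    qed
    then have "H = {xs. length xs = m \<and> holds M (Conj (carF m \<phi> 1) (bicentralF m \<phi> \<psi> r)) (setb m {1} (\<lambda>_. xs) e1)}"
      using subgroup.mem_carrier[OF H] len by blast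
    then show ?thesis by (rule ssubst) (rule definable_setb)
  qed
  \<comment> \<open>One element is taken in the centralizer of \<open>E\<close>, the other in the
    centralizer of that centralizer.\<close>
  moreover have "\<forall>x\<in>H. \<forall>y\<in>H. x \<otimes>\<^bsub>G\<^esub> y = y \<otimes>\<^bsub>G\<^esub> x"
    unfolding H_def centr_def[of "centr _"] by blast
  moreover have "bounded_index (carrier G) ?mu r N E \<longleftrightarrow> (\<forall>S. separated H S \<longrightarrow> card S \<le> N)"
    unfolding H_def by (rule bounded_index_iff[OF G]) (use mu E in simp_all)
  then have "card S \<le> N" if "separated H S" for S using bi that by blast
  then have "finite (rcosets\<^bsub>G\<^esub> H)" by (rule finite_rcosets_of_separated_bound[OF H])
  ultimately show ?thesis using H by blast
qed

end
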